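(* Let $(H,d)$ be a Hadamard space. Let $X_1,X_2,\dots$ be independent $H$-valued random variables with expectations $\mathbb{E}(X_k)=\mu_k$ and let $Y_1,Y_2,\dots$ be independent $H$-valued random variables with expectations $\mathbb{E}(Y_k)=\nu_k$. For each $n\ge1$ let $1\le r_n\le n$ be a deterministic integer (the contamination level), and assume that the family $\{X_1,\dots,X_n,Y_1,\dots,Y_{r_n}\}$ is independent. For each $n$, let $Z_1,\dots,Z_n$ be generated from $X_1,\dots,X_n$ by replacing $r_n$ of the $X_i$'s (at deterministic positions) with the $Y_j$'s, $1\le j\le r_n$, each $Y_j$ being used exactly once, and let $S_n$ be the inductive mean of $Z_1,\dots,Z_n$. If there is $\mu\in H$ such that for some $p>\frac12$, $C>0$, $0\le q<\min\{\frac14,\,p-\frac12\}$ and $z\in H$ we have 1. $\frac1n\sum_{k=1}^n d(\mu_k,\mu)=O(n^{-p})$, 2. $\frac1n\sum_{k=1}^{r_n}d(\nu_k,\mu)=O(n^{-p})$, 3. $\mathbb{P}(\max_{1\le k\le n}d(X_k,z)\le Cn^q)=1$ for all $n\ge1$, and 4. $\mathbb{P}(\max_{1\le k\le r_n}d(Y_k,z)\le Cn^q)=1$ for all $n\ge1$, then $S_n\to\mu$ almost surely.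
   Context: A Hadamard space is a complete metric space $(H,d)$ such that for all $x,y\in H$ there is $m\in H$ with $d(z,m)^2\le\frac12 d(z,x)^2+\frac12 d(z,y)^2-\frac14 d(x,y)^2$ for all $z\in H$. Any two points $x,y\in H$ are joined by a unique minimal geodesic, i.e. a map $\gamma:[0,1]\to H$ with $\gamma(0)=x$, $\gamma(1)=y$, $d(\gamma(s),\gamma(t))=|t-s|\,d(x,y)$; write $x\oplus_t y=\gamma(t)$. The inductive mean of $x_1,\dots,x_n$ is $S_n$, where $S_1=x_1$, $S_{k+1}=S_k\oplus_{\frac1{k+1}}x_{k+1}$ (applied pointwise to random variables). A random variable in $H$ is a Borel measurable map from a probability space to $H$. For $X$ with $\mathbb{E}(d(X,z)^2)<\infty$ for some (equivalently all) $z\in H$, the expectation $\mathbb{E}(X)\in H$ is the unique minimizer of $z\mapsto\mathbb{E}(d(X,z)^2)$ over $H$.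
   Formalization: Random variables are Borel maps whose law has separable support (automatic if H is separable or no real-valued measurable cardinal exists); for arbitrary Borel maps the claim fails if a measurable cardinal exists (diffuse two-valued law on the endpoints of a star). *)

theory Defs
  imports "HOL-Probability.Probability" "HOL-Library.Landau_Symbols"
begin

class hadamard_space = complete_space +
  assumes hadamard_midpoint:
    "\<exists>m. \<forall>z. (dist z m)\<^sup>2 \<le> 1/2 * (dist z x)\<^sup>2 + 1/2 * (dist z y)\<^sup>2 - 1/4 * (dist x y)\<^sup>2"

text \<open>Only the values on the unit interval matter; \<open>\<gamma>\<close> is unconstrained outside it.\<close>

definition geodesic_between :: "'a::metric_space \<Rightarrow> 'a \<Rightarrow> (real \<Rightarrow> 'a) \<Rightarrow> bool" where
  "geodesic_between x y \<gamma> \<longleftrightarrow> \<gamma> 0 = x \<and> \<gamma> 1 = y \<and>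
     (\<forall>s\<in>{0..1}. \<forall>t\<in>{0..1}. dist (\<gamma> s) (\<gamma> t) = \<bar>t - s\<bar> * dist x y)"

text \<open>The point \<open>x \<oplus>\<^sub>t y\<close>. In a Hadamard space minimal geodesics exist and are unique, so
  the description is proper for \<open>t\<close> in the unit interval.\<close>

definition geodesic_point :: "'a::hadamard_space \<Rightarrow> real \<Rightarrow> 'a \<Rightarrow> 'a" where
  "geodesic_point x t y = (THE w. \<exists>\<gamma>. geodesic_between x y \<gamma> \<and> w = \<gamma> t)"

text \<open>Sequences are indexed from 1; the value at \<open>0\<close> is irrelevant.\<close>

fun inductive_mean :: "(nat \<Rightarrow> 'a::hadamard_space) \<Rightarrow> nat \<Rightarrow> 'a" where
  "inductive_mean x 0 = undefined"
| "inductive_mean x (Suc 0) = x 1"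
| "inductive_mean x (Suc (Suc k)) =
     geodesic_point (inductive_mean x (Suc k)) (1 / real (Suc (Suc k))) (x (Suc (Suc k)))"

text \<open>Borel measurable maps whose law has separable support. The second conjunct is
  automatic when the space is separable. In a non-separable space it excludes
  only laws whose existence would require a real-valued measurable cardinal. For such laws the strong law can fail:
  a diffuse two-valued law on the endpoints of a star with unit legs has the centre as its
  expectation, yet a variable \<open>X\<close> with this law is independent of itself, and all inductive
  means of \<open>X, X, \<dots>\<close> are equal to \<open>X\<close>.\<close>

definition hadamard_rv :: "'w measure \<Rightarrow> ('w \<Rightarrow> 'a::hadamard_space) \<Rightarrow> bool" where
  "hadamard_rv M X \<longleftrightarrow> X \<in> borel_measurable M \<and>
     (\<exists>D. countable D \<and> (AE \<omega> in M. X \<omega> \<in> closure D))"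

definition square_integrable :: "'w measure \<Rightarrow> ('w \<Rightarrow> 'a::hadamard_space) \<Rightarrow> bool" where
  "square_integrable M X \<longleftrightarrow> (\<exists>z. integrable M (\<lambda>\<omega>. (dist (X \<omega>) z)\<^sup>2))"

text \<open>Meaningful only for square integrable \<open>X\<close>, for which the minimizer exists and is unique.\<close>

definition hadamard_expectation :: "'w measure \<Rightarrow> ('w \<Rightarrow> 'a::hadamard_space) \<Rightarrow> 'a" where
  "hadamard_expectation M X =
     (THE m. \<forall>z. (\<integral>\<omega>. (dist (X \<omega>) m)\<^sup>2 \<partial>M) \<le> (\<integral>\<omega>. (dist (X \<omega>) z)\<^sup>2 \<partial>M))"

text \<open>\<open>A\<close> is the set of replaced positions and \<open>\<pi> i\<close> the index of the \<open>Y\<close> put at position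
  \<open>i\<close>; neither depends on the sample point.\<close>

definition contamination ::
  "nat \<Rightarrow> nat \<Rightarrow> (nat \<Rightarrow> 'w \<Rightarrow> 'a) \<Rightarrow> (nat \<Rightarrow> 'w \<Rightarrow> 'a) \<Rightarrow> (nat \<Rightarrow> 'w \<Rightarrow> 'a) \<Rightarrow> bool" where
  "contamination n r X Y Z \<longleftrightarrow>
     (\<exists>A \<pi>. A \<subseteq> {1..n} \<and> card A = r \<and> bij_betw \<pi> A {1..r} \<and>
        (\<forall>i\<in>{1..n}. Z i = (if i \<in> A then Y (\<pi> i) else X i)))"

end

theory Submission
  imports Defs "HOL-Real_Asymp.Real_Asymp"
begin

text \<open>
  The samples with different \<open>n\<close> need not be nested, so \<open>S\<^sub>n\<close> is not obtained from \<open>S\<^sub>n\<^sub>-\<^sub>1\<close> and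
  almost sure convergence has to come from Borel and Cantelli: the probabilities of
  \<open>d(S\<^sub>n, \<mu>) \<ge> \<epsilon>\<close> must be summable in \<open>n\<close>. Second moments are too weak for that; an exponential
  moment of \<open>n\<^sup>2 d(S\<^sub>n, \<mu>)\<^sup>2\<close> is strong enough, and it can be bounded one observation at a time.

  Fix \<open>n\<close> and let \<open>u\<^sub>k = k\<^sup>2 d(S\<^sub>k, \<mu>)\<^sup>2\<close>, where \<open>S\<^sub>k\<close> is the mean of the first \<open>k\<close> entries of row \<open>n\<close>.
  The inequality of nonpositive curvature along the geodesic from \<open>S\<^sub>k\<close> to the next
  observation \<open>x\<close> reads
  \<open>u\<^sub>k\<^sub>+\<^sub>1 \<le> k (k+1) d(S\<^sub>k, \<mu>)\<^sup>2 + (k+1) d(x, \<mu>)\<^sup>2 - k d(x, S\<^sub>k)\<^sup>2\<close>.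
  If all points lie in a ball of radius \<open>B\<close> and \<open>x\<close> has expectation \<open>m\<close>, the variance inequality
  \<open>E d(x, m)\<^sup>2 + d(m, s)\<^sup>2 \<le> E d(x, s)\<^sup>2\<close> shows that the right-hand side has conditional mean at most
  \<open>u\<^sub>k + B\<^sup>2 + 8 B (k+1) d(m, \<mu>)\<close>, and its range has length at most \<open>8 B\<^sup>2 (k+1)\<close>. Hoeffding's lemma and
  Fubini then give, by induction on \<open>k\<close> (lemmas \<open>exp_moment_step\<close> and \<open>exp_moment_inductive_mean\<close>),
  with \<open>m\<^sub>i\<close> the expectation of the \<open>i\<close>-th entry,
  \<open>E exp(l u\<^sub>n) \<le> exp(l (5 B\<^sup>2 n + 8 B n \<Sum> d(m\<^sub>i, \<mu>)) + 8 l\<^sup>2 B\<^sup>4 n\<^sup>3)\<close>.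

  Here \<open>B\<close> is of order \<open>n\<^sup>q\<close> and the sum of the \<open>d(m\<^sub>i, \<mu>)\<close> of order \<open>n\<close> to the power \<open>1 - p\<close>. Markov's
  inequality with \<open>l\<close> a small multiple of \<open>n\<close> to the power \<open>- 1 - 4 q\<close> bounds the probability of
  \<open>u\<^sub>n \<ge> \<epsilon>\<^sup>2 n\<^sup>2\<close> by the exponential of a negative multiple of \<open>n\<close> to the power \<open>1 - 4 q\<close>, the
  contribution of the bias being of lower order because \<open>q < p\<close>. These bounds are summable
  because \<open>q < 1/4\<close>. This proves a strong law for triangular arrays with independent rows
  (lemma \<open>strong_law_triangular_array\<close>), and contaminated samples form such an array.

  Since the space need not be separable, the Borel sets of a product may exceed the product of the
  Borel sets, so measurability of the means is not automatic. It is recovered from the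
  separable supports of the laws: a map with values in a separable closed set is a limit of maps with
  countable range, and continuous operations on such maps cause no difficulty.
\<close>

section \<open>Geodesics in Hadamard spaces\<close>

text \<open>
  The Bruhat-Tits inequality, as a property that singles out the point at parameter \<open>t\<close> on the geodesic
  from \<open>x\<close> to \<open>y\<close>. The defining axiom of Hadamard spaces provides such a point for \<open>t = 1/2\<close>.
\<close>

definition cn_point :: "'a::metric_space \<Rightarrow> real \<Rightarrow> 'a \<Rightarrow> 'a \<Rightarrow> bool" where
  "cn_point x t y w \<longleftrightarrow>
     (\<forall>z. (dist z w)\<^sup>2 \<le> (1 - t) * (dist z x)\<^sup>2 + t * (dist z y)\<^sup>2 - t * (1 - t) * (dist x y)\<^sup>2)"

lemma cn_pointD:
  "cn_point x t y w \<Longrightarrow>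
     (dist z w)\<^sup>2 \<le> (1 - t) * (dist z x)\<^sup>2 + t * (dist z y)\<^sup>2 - t * (1 - t) * (dist x y)\<^sup>2"
  by (simp add: cn_point_def)

text \<open>
  Testing the inequality at the two endpoints gives upper bounds for the two distances; as these add
  up to \<open>d(x, y)\<close>, the triangle inequality makes both of them sharp.
\<close>

lemma cn_point_dist_endpoints:
  assumes "cn_point x t y w" and t: "0 \<le> t" "t \<le> 1"
  shows "dist x w = t * dist x y" and "dist w y = (1 - t) * dist x y"
proof -
  have "(dist x w)\<^sup>2 \<le> (t * dist x y)\<^sup>2"
    using cn_pointD[OF assms(1), of x] by (simp add: power2_eq_square algebra_simps)
  then have 1: "dist x w \<le> t * dist x y"
    by (rule power2_le_imp_le) (use t in simp)
  have "(dist y w)\<^sup>2 \<le> ((1 - t) * dist x y)\<^sup>2"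
    using cn_pointD[OF assms(1), of y]
    by (simp add: power2_eq_square algebra_simps dist_commute)
  then have 2: "dist w y \<le> (1 - t) * dist x y"
    unfolding dist_commute[of y w] by (rule power2_le_imp_le) (use t in simp)
  have "dist x y \<le> dist x w + dist w y"
    by (rule dist_triangle)
  with 1 2 show "dist x w = t * dist x y" and "dist w y = (1 - t) * dist x y"
    by (auto simp: algebra_simps)
qed

text \<open>
  The point \<open>w\<close> has only the right distances to the endpoints; this is what makes geodesics unique,
  as one may take \<open>s = t\<close>.
\<close>

lemma cn_point_dist_le:
  assumes "cn_point x s y v" "0 \<le> t" "t \<le> 1" "0 \<le> s" "s \<le> 1"
    and w: "dist x w = t * dist x y" "dist w y = (1 - t) * dist x y"
  shows "dist v w \<le> \<bar>t - s\<bar> * dist x y"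
proof -
  have "(dist w v)\<^sup>2 \<le> (\<bar>t - s\<bar> * dist x y)\<^sup>2"
    using cn_pointD[OF assms(1), of w] w
    by (simp add: power_mult_distrib dist_commute[of w x])
       (simp add: power2_eq_square algebra_simps)
  then have "dist w v \<le> \<bar>t - s\<bar> * dist x y"
    by (rule power2_le_imp_le) simp
  then show ?thesis
    by (simp add: dist_commute)
qed

lemma cn_point_dist:
  assumes v: "cn_point x s y v" and w: "cn_point x t y w"
    and st: "0 \<le> s" "s \<le> 1" "0 \<le> t" "t \<le> 1"
  shows "dist v w = \<bar>t - s\<bar> * dist x y"
proof (rule antisym)
  show "dist v w \<le> \<bar>t - s\<bar> * dist x y"
    using cn_point_dist_le[OF v] cn_point_dist_endpoints[OF w] st by simp
  note d = cn_point_dist_endpoints[OF v st(1,2)] cn_point_dist_endpoints[OF w st(3,4)]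
  have "dist x w \<le> dist x v + dist v w" "dist x v \<le> dist x w + dist w v"
    by (rule dist_triangle)+
  then show "\<bar>t - s\<bar> * dist x y \<le> dist v w"
    using d by (auto simp: dist_commute[of w v] abs_if algebra_simps)
qed

text \<open>
  Averaging the two inequalities leaves exactly the right multiple of \<open>d(x, y)\<^sup>2\<close>, because
  \<open>d(v, w) = |t - s| d(x, y)\<close> is known as an equality.
\<close>

lemma cn_point_midpoint:
  fixes x y :: "'a::hadamard_space"
  assumes v: "cn_point x s y v" and w: "cn_point x t y w"
    and st: "0 \<le> s" "s \<le> 1" "0 \<le> t" "t \<le> 1"
  shows "\<exists>m. cn_point x ((s + t) / 2) y m"
proof -
  obtain m where
    m: "\<And>z. (dist z m)\<^sup>2 \<le> 1/2 * (dist z v)\<^sup>2 + 1/2 * (dist z w)\<^sup>2 - 1/4 * (dist v w)\<^sup>2"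
    using hadamard_midpoint by blast
  have "cn_point x ((s + t) / 2) y m"
    unfolding cn_point_def
  proof
    fix z
    have "(dist v w)\<^sup>2 = (t - s)\<^sup>2 * (dist x y)\<^sup>2"
      by (simp add: cn_point_dist[OF v w st] power_mult_distrib)
    then have "(dist z m)\<^sup>2
      \<le> 1/2 * ((1 - s) * (dist z x)\<^sup>2 + s * (dist z y)\<^sup>2 - s * (1 - s) * (dist x y)\<^sup>2)
      + 1/2 * ((1 - t) * (dist z x)\<^sup>2 + t * (dist z y)\<^sup>2 - t * (1 - t) * (dist x y)\<^sup>2)
      - 1/4 * ((t - s)\<^sup>2 * (dist x y)\<^sup>2)"
      by (intro order_trans[OF m[of z]] diff_mono add_mono mult_left_mono
          cn_pointD[OF v] cn_pointD[OF w]) auto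
    also have "\<dots> = (1 - (s + t) / 2) * (dist z x)\<^sup>2 + (s + t) / 2 * (dist z y)\<^sup>2
      - (s + t) / 2 * (1 - (s + t) / 2) * (dist x y)\<^sup>2"
      by (simp add: power2_eq_square field_simps)
    finally show "(dist z m)\<^sup>2 \<le> \<dots>" .
  qed
  then show ?thesis ..
qed

text \<open>
  For \<open>t\<close> outside \<open>T\<close> the midpoint of the two points of \<open>T\<close> next to \<open>t\<close> would lie in the gap between
  them.
\<close>

lemma closed_midpoint_closed_unit_interval:
  fixes T :: "real set"
  assumes "closed T" "0 \<in> T" "1 \<in> T" and T: "T \<subseteq> {0..1}"
    and mid: "\<And>s t. s \<in> T \<Longrightarrow> t \<in> T \<Longrightarrow> (s + t) / 2 \<in> T"
  shows "T = {0..1}"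
proof (rule equalityI[OF T], rule subsetI)
  fix t :: real
  assume t: "t \<in> {0..1}"
  have L: "T \<inter> {0..t} \<noteq> {}" "closed (T \<inter> {0..t})" "bdd_above (T \<inter> {0..t})"
    using assms t by (auto intro!: closed_Int bdd_above.I[of _ t])
  have R: "T \<inter> {t..1} \<noteq> {}" "closed (T \<inter> {t..1})" "bdd_below (T \<inter> {t..1})"
    using assms t by (auto intro!: closed_Int bdd_below.I[of _ t])
  define a where "a = Sup (T \<inter> {0..t})"
  define b where "b = Inf (T \<inter> {t..1})"
  have a: "a \<in> T" "a \<le> t"
    using closed_contains_Sup[OF L(1,3,2)] by (auto simp: a_def)
  have b: "b \<in> T" "t \<le> b"
    using closed_contains_Inf[OF R(1,3,2)] by (auto simp: b_def)
  have c: "(a + b) / 2 \<in> T"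
    by (rule mid[OF a(1) b(1)])
  show "t \<in> T"
  proof (cases "(a + b) / 2 \<le> t")
    case True
    then have "(a + b) / 2 \<le> a"
      unfolding a_def using c T by (intro cSup_upper[OF _ L(3)]) (auto simp: a_def)
    then have "t \<le> a"
      using b(2) by simp
    then show ?thesis
      using a by simp
  next
    case False
    then have "b \<le> (a + b) / 2"
      unfolding b_def using c T by (intro cInf_lower[OF _ R(3)]) (auto simp: b_def)
    then have "b \<le> t"
      using a(2) by simp
    then show ?thesis
      using b by simp
  qed
qed

text \<open>
  The parameters for which a point exists contain \<open>0\<close> and \<open>1\<close> and are closed under midpoints. They
  are closed under limits since points with converging parameters form a Cauchy sequence, by
  the distance formula, and the space is complete.
\<close>

lemma cn_point_exists:
  fixes x y :: "'a::hadamard_space"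
  assumes "0 \<le> t" "t \<le> 1"
  shows "\<exists>w. cn_point x t y w"
proof -
  define T where "T = {t\<in>{0..1}. \<exists>w. cn_point x t y w}"
  have "closed T"
    unfolding closed_sequential_limits
  proof (intro allI impI, elim conjE)
    fix u l
    assume u: "\<forall>n. u n \<in> T" and ul: "u \<longlonglongrightarrow> l"
    have u01: "0 \<le> u n" "u n \<le> 1" for n
      using u by (auto simp: T_def)
    have l01: "l \<in> {0..1}"
      using u01 LIMSEQ_le_const[OF ul] LIMSEQ_le_const2[OF ul] by auto
    obtain w where w: "\<And>n. cn_point x (u n) y (w n)"
      using u unfolding T_def by simp metis
    have "Cauchy w"
    proof (rule metric_CauchyI)
      fix e :: real
      assume e: "0 < e"
      have "Cauchy u"
        using ul by (rule LIMSEQ_imp_Cauchy)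
      then obtain N where N: "\<And>m n. m \<ge> N \<Longrightarrow> n \<ge> N \<Longrightarrow> dist (u m) (u n) < e / (dist x y + 1)"
        using e metric_CauchyD[of u "e / (dist x y + 1)"] by (auto simp: add_nonneg_pos)
      have "dist (w m) (w n) < e" if "m \<ge> N" "n \<ge> N" for m n
      proof -
        have "dist (w m) (w n) = dist (u m) (u n) * dist x y"
          using cn_point_dist[OF w w u01 u01] by (simp add: dist_real_def abs_minus_commute)
        also have "\<dots> \<le> dist (u m) (u n) * (dist x y + 1)"
          by (intro mult_left_mono) auto
        also have "\<dots> < e"
          using N[OF that] by (simp add: pos_less_divide_eq add_nonneg_pos)
        finally show ?thesis .
      qed
      then show "\<exists>N. \<forall>m\<ge>N. \<forall>n\<ge>N. dist (w m) (w n) < e"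
        by blast
    qed
    then obtain v where v: "w \<longlonglongrightarrow> v"
      using Cauchy_convergent convergent_def by blast
    have "cn_point x l y v"
      unfolding cn_point_def
    proof
      fix z
      show "(dist z v)\<^sup>2 \<le> (1 - l) * (dist z x)\<^sup>2 + l * (dist z y)\<^sup>2 - l * (1 - l) * (dist x y)\<^sup>2"
        by (rule LIMSEQ_le[of "\<lambda>n. (dist z (w n))\<^sup>2" _ "\<lambda>n. (1 - u n) * (dist z x)\<^sup>2
              + u n * (dist z y)\<^sup>2 - u n * (1 - u n) * (dist x y)\<^sup>2"])
           (use cn_pointD[OF w] in \<open>auto intro!: tendsto_intros ul v\<close>)
    qed
    with l01 show "l \<in> T"
      by (auto simp: T_def)
  qed
  moreover have "cn_point x 0 y x" "cn_point x 1 y y"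
    by (auto simp: cn_point_def)
  then have "0 \<in> T" "1 \<in> T"
    by (auto simp: T_def)
  moreover have "T \<subseteq> {0..1}"
    by (auto simp: T_def)
  moreover have "(s + t) / 2 \<in> T" if "s \<in> T" "t \<in> T" for s t
    using that cn_point_midpoint[of x s y _ t] by (auto simp: T_def)
  ultimately have "T = {0..1}"
    by (rule closed_midpoint_closed_unit_interval)
  with assms show ?thesis
    by (auto simp: T_def)
qed

text \<open>
  The constructed points form a geodesic, and every geodesic agrees with it, so the definite
  description in \<^const>\<open>geodesic_point\<close> denotes them.
\<close>

lemma geodesic_point_cn:
  fixes x y :: "'a::hadamard_space"
  assumes t: "0 \<le> t" "t \<le> 1"
  shows "cn_point x t y (geodesic_point x t y)"
proof -
  obtain \<gamma> where \<gamma>: "\<And>s. 0 \<le> s \<Longrightarrow> s \<le> 1 \<Longrightarrow> cn_point x s y (\<gamma> s)"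
    using cn_point_exists[of _ x y] by metis
  have "geodesic_between x y \<gamma>"
    unfolding geodesic_between_def
    using cn_point_dist[OF \<gamma> \<gamma>] cn_point_dist_endpoints[OF \<gamma>, of 0]
      cn_point_dist_endpoints[OF \<gamma>, of 1] by auto
  moreover have "\<delta> t = \<gamma> t" if "geodesic_between x y \<delta>" for \<delta>
  proof -
    have \<delta>: "\<delta> 0 = x" "\<delta> 1 = y"
      and iso: "\<And>a b. a \<in> {0..1} \<Longrightarrow> b \<in> {0..1} \<Longrightarrow> dist (\<delta> a) (\<delta> b) = \<bar>b - a\<bar> * dist x y"
      using that unfolding geodesic_between_def by auto
    have "dist x (\<delta> t) = t * dist x y" "dist (\<delta> t) y = (1 - t) * dist x y"
      using iso[of 0 t] iso[of t 1] \<delta> t by auto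
    from cn_point_dist_le[OF \<gamma>[OF t] t t this] show ?thesis
      by simp
  qed
  ultimately have "geodesic_point x t y = \<gamma> t"
    unfolding geodesic_point_def by (intro the_equality) blast+
  then show ?thesis
    using \<gamma>[OF t] by simp
qed

lemma geodesic_point_in_cball:
  fixes x y :: "'a::hadamard_space"
  assumes t: "0 \<le> t" "t \<le> 1" and "x \<in> cball z B" "y \<in> cball z B"
  shows "geodesic_point x t y \<in> cball z B"
proof -
  have B: "0 \<le> B"
    using assms(3) zero_le_dist[of z x] unfolding mem_cball by linarith
  have "(dist z (geodesic_point x t y))\<^sup>2
      \<le> (1 - t) * (dist z x)\<^sup>2 + t * (dist z y)\<^sup>2 - t * (1 - t) * (dist x y)\<^sup>2"
    by (rule cn_pointD[OF geodesic_point_cn[OF t]])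
  also have "\<dots> \<le> (1 - t) * B\<^sup>2 + t * B\<^sup>2 - 0"
    using assms by (intro diff_mono add_mono mult_left_mono power_mono) auto
  also have "\<dots> = B\<^sup>2"
    by (simp add: algebra_simps)
  finally show ?thesis
    using B by (auto intro: power2_le_imp_le)
qed

text \<open>
  The inequality for the limit point, tested at \<open>a\<^sub>n \<oplus>\<^sub>t b\<^sub>n\<close>, bounds the distance by an expression
  that tends to \<open>0\<close>, since the distances of \<open>a\<^sub>n \<oplus>\<^sub>t b\<^sub>n\<close> to \<open>x\<close> and \<open>y\<close> tend to \<open>t d(x, y)\<close> and \<open>(1 - t) d(x, y)\<close>.
\<close>

lemma continuous_on_geodesic_point:
  assumes t: "0 \<le> t" "t \<le> 1"
  shows "continuous_on UNIV (\<lambda>(x, y). geodesic_point x t y :: 'a::hadamard_space)"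
  unfolding continuous_on_sequentially
proof (intro allI ballI impI, elim conjE)
  fix u :: "nat \<Rightarrow> 'a \<times> 'a" and p
  assume up: "u \<longlonglongrightarrow> p"
  define x where "x = fst p"
  define y where "y = snd p"
  define a where "a = (\<lambda>n. fst (u n))"
  define b where "b = (\<lambda>n. snd (u n))"
  have a: "a \<longlonglongrightarrow> x" and b: "b \<longlonglongrightarrow> y"
    unfolding a_def b_def x_def y_def using up by (auto intro: tendsto_fst tendsto_snd)
  let ?w = "geodesic_point x t y"
  let ?v = "\<lambda>n. geodesic_point (a n) t (b n)"
  have "(\<lambda>n. (dist (?v n) ?w)\<^sup>2) \<longlonglongrightarrow> 0"
  proof (rule tendsto_sandwich[OF _ _ tendsto_const])
    let ?g = "\<lambda>n. (1 - t) * (dist (a n) x + t * dist (a n) (b n))\<^sup>2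
      + t * ((1 - t) * dist (a n) (b n) + dist (b n) y)\<^sup>2 - t * (1 - t) * (dist x y)\<^sup>2"
    have "(dist (?v n) ?w)\<^sup>2 \<le> ?g n" for n
    proof -
      note d = cn_point_dist_endpoints[OF geodesic_point_cn[OF t, of "a n" "b n"] t]
      have 1: "dist (?v n) x \<le> dist (a n) x + t * dist (a n) (b n)"
        using d(1) dist_triangle[of "?v n" x "a n"] dist_commute[of "?v n" "a n"] by linarith
      have 2: "dist (?v n) y \<le> (1 - t) * dist (a n) (b n) + dist (b n) y"
        using d(2) dist_triangle[of "?v n" y "b n"] by linarith
      have "(dist (?v n) ?w)\<^sup>2 \<le> (1 - t) * (dist (?v n) x)\<^sup>2 + t * (dist (?v n) y)\<^sup>2
          - t * (1 - t) * (dist x y)\<^sup>2"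
        by (rule cn_pointD[OF geodesic_point_cn[OF t]])
      also have "\<dots> \<le> ?g n"
        using t 1 2 by (intro diff_mono add_mono mult_left_mono power_mono) auto
      finally show ?thesis .
    qed
    then show "\<forall>\<^sub>F n in sequentially. (dist (?v n) ?w)\<^sup>2 \<le> ?g n"
      by simp
    have "?g \<longlonglongrightarrow> (1 - t) * (dist x x + t * dist x y)\<^sup>2
      + t * ((1 - t) * dist x y + dist y y)\<^sup>2 - t * (1 - t) * (dist x y)\<^sup>2"
      by (intro tendsto_intros a b)
    also have "(1 - t) * (dist x x + t * dist x y)\<^sup>2
      + t * ((1 - t) * dist x y + dist y y)\<^sup>2 - t * (1 - t) * (dist x y)\<^sup>2 = 0"
      by (simp add: power2_eq_square algebra_simps)
    finally show "?g \<longlonglongrightarrow> 0" .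
  qed simp
  then have "(\<lambda>n. sqrt ((dist (?v n) ?w)\<^sup>2)) \<longlonglongrightarrow> sqrt 0"
    by (rule tendsto_real_sqrt)
  then have "?v \<longlonglongrightarrow> ?w"
    by (subst tendsto_dist_iff) simp
  then show "((\<lambda>(x, y). geodesic_point x t y) \<circ> u) \<longlonglongrightarrow> (\<lambda>(x, y). geodesic_point x t y) p"
    by (simp add: a_def b_def x_def y_def case_prod_unfold comp_def)
qed

section \<open>Expectations and the variance inequality\<close>

text \<open>
  Strong convexity at midpoints makes minimizing sequences Cauchy. The quadratic growth comes from
  comparing \<open>F m\<close> with the value at \<open>m \<oplus>\<^sub>t s\<close> and letting \<open>t\<close> tend to \<open>0\<close>.
\<close>

lemma strongly_convex_has_minimizer:
  fixes F :: "'a::hadamard_space \<Rightarrow> real"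
  assumes conv: "\<And>x y t. 0 \<le> t \<Longrightarrow> t \<le> 1 \<Longrightarrow>
      F (geodesic_point x t y) \<le> (1 - t) * F x + t * F y - t * (1 - t) * (dist x y)\<^sup>2"
    and cont: "continuous_on UNIV F"
    and nonneg: "\<And>x. 0 \<le> F x"
  shows "\<exists>m. \<forall>s. F m + (dist m s)\<^sup>2 \<le> F s"
proof -
  define I where "I = (INF x. F x)"
  have bdd: "bdd_below (range F)"
    using nonneg by (intro bdd_belowI2)
  have I: "I \<le> F x" for x
    unfolding I_def by (rule cINF_lower[OF bdd]) simp
  have "\<exists>a. F a < I + 1 / real (Suc n)" for n
    using cINF_less_iff[OF _ bdd, of "I + 1 / real (Suc n)"] by (auto simp: I_def)
  then obtain a where a: "\<And>n. F (a n) < I + 1 / real (Suc n)"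
    by metis
  have close: "(dist (a n) (a k))\<^sup>2 \<le> 2 / real (Suc n) + 2 / real (Suc k)" for n k
    using conv[of "1/2" "a n" "a k"] I[of "geodesic_point (a n) (1/2) (a k)"] a[of n] a[of k]
    by simp
  have "Cauchy a"
  proof (rule metric_CauchyI)
    fix e :: real
    assume e: "0 < e"
    obtain N where N: "inverse (real (Suc N)) < e\<^sup>2 / 4"
      using reals_Archimedean[of "e\<^sup>2 / 4"] e by auto
    have "dist (a n) (a k) < e" if "n \<ge> N" "k \<ge> N" for n k
    proof -
      have "1 / real (Suc n) \<le> 1 / real (Suc N)" "1 / real (Suc k) \<le> 1 / real (Suc N)"
        using that by (auto intro!: divide_left_mono)
      then have "(dist (a n) (a k))\<^sup>2 < e\<^sup>2"
        using close[of n k] N by (simp add: inverse_eq_divide)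
      then show ?thesis
        using e by (auto intro: power2_less_imp_less)
    qed
    then show "\<exists>N. \<forall>n\<ge>N. \<forall>k\<ge>N. dist (a n) (a k) < e"
      by blast
  qed
  then obtain m where m: "a \<longlonglongrightarrow> m"
    using Cauchy_convergent convergent_def by blast
  have "(\<lambda>n. F (a n)) \<longlonglongrightarrow> F m"
    using cont m by (intro continuous_on_tendsto_compose[of UNIV F]) auto
  moreover have "(\<lambda>n. I + 1 / real (Suc n)) \<longlonglongrightarrow> I + 0"
    by (intro tendsto_intros LIMSEQ_Suc[OF lim_1_over_n])
  ultimately have "F m \<le> I + 0"
    by (rule LIMSEQ_le) (use a less_imp_le in blast)
  then have min: "F m \<le> F x" for x
    using I[of x] by simp
  have "F m + (dist m s)\<^sup>2 \<le> F s" for s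
  proof -
    have grow: "F m + (1 - t) * (dist m s)\<^sup>2 \<le> F s" if t: "0 < t" "t \<le> 1" for t
    proof -
      have "F m \<le> (1 - t) * F m + t * F s - t * (1 - t) * (dist m s)\<^sup>2"
        using min[of "geodesic_point m t s"] conv[of t m s] t by linarith
      then have "t * (F m + (1 - t) * (dist m s)\<^sup>2) \<le> t * F s"
        by (simp add: algebra_simps)
      then show ?thesis
        using t by simp
    qed
    have "(\<lambda>n. F m + (1 - 1 / real (Suc n)) * (dist m s)\<^sup>2) \<longlonglongrightarrow> F m + (1 - 0) * (dist m s)\<^sup>2"
      by (intro tendsto_intros LIMSEQ_Suc[OF lim_1_over_n])
    then have "F m + (1 - 0) * (dist m s)\<^sup>2 \<le> F s"
      by (rule LIMSEQ_le_const2) (use grow in auto)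
    then show ?thesis
      by simp
  qed
  then show ?thesis
    by blast
qed

lemma borel_measurable_dist_const [measurable]:
  fixes X :: "'w \<Rightarrow> 'a::metric_space"
  assumes "X \<in> borel_measurable M"
  shows "(\<lambda>\<omega>. dist (X \<omega>) s) \<in> borel_measurable M"
proof -
  have "(\<lambda>x. dist x s) \<in> borel_measurable borel"
    by (intro borel_measurable_continuous_onI continuous_intros)
  from measurable_compose[OF assms this] show ?thesis .
qed

lemma (in prob_space) square_integrable_dist:
  fixes X :: "'a \<Rightarrow> 'b::hadamard_space"
  assumes X [measurable]: "X \<in> borel_measurable M" and "square_integrable M X"
  shows "integrable M (\<lambda>\<omega>. (dist (X \<omega>) s)\<^sup>2)" and "integrable M (\<lambda>\<omega>. dist (X \<omega>) s)"
proof -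
  obtain z where z: "integrable M (\<lambda>\<omega>. (dist (X \<omega>) z)\<^sup>2)"
    using assms by (auto simp: square_integrable_def)
  show sq: "integrable M (\<lambda>\<omega>. (dist (X \<omega>) s)\<^sup>2)"
  proof (rule Bochner_Integration.integrable_bound[where f = "\<lambda>\<omega>. 2 * (dist (X \<omega>) z)\<^sup>2 + 2 * (dist z s)\<^sup>2"])
    have "(dist (X \<omega>) s)\<^sup>2 \<le> 2 * (dist (X \<omega>) z)\<^sup>2 + 2 * (dist z s)\<^sup>2" for \<omega>
    proof -
      have "(dist (X \<omega>) s)\<^sup>2 \<le> (dist (X \<omega>) z + dist z s)\<^sup>2"
        by (intro power_mono dist_triangle) auto
      also have "\<dots> \<le> 2 * (dist (X \<omega>) z)\<^sup>2 + 2 * (dist z s)\<^sup>2"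
        using sum_squares_bound[of "dist (X \<omega>) z" "dist z s"] by (simp add: power2_sum)
      finally show ?thesis .
    qed
    then show "AE \<omega> in M. norm ((dist (X \<omega>) s)\<^sup>2) \<le> norm (2 * (dist (X \<omega>) z)\<^sup>2 + 2 * (dist z s)\<^sup>2)"
      by simp
  qed (use z in auto)
  show "integrable M (\<lambda>\<omega>. dist (X \<omega>) s)"
  proof (rule Bochner_Integration.integrable_bound[where f = "\<lambda>\<omega>. 1 + (dist (X \<omega>) s)\<^sup>2"])
    have "dist (X \<omega>) s \<le> 1 + (dist (X \<omega>) s)\<^sup>2" for \<omega>
    proof -
      have "2 * dist (X \<omega>) s \<le> (dist (X \<omega>) s)\<^sup>2 + 1"
        using sum_squares_bound[of "dist (X \<omega>) s" 1] by simp
      then show ?thesis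
        using zero_le_dist[of "X \<omega>" s] by linarith
    qed
    then show "AE \<omega> in M. norm (dist (X \<omega>) s) \<le> norm (1 + (dist (X \<omega>) s)\<^sup>2)"
      by simp
  qed (use sq in auto)
qed

text \<open>
  Integrating the inequality for geodesic points shows that \<open>z \<mapsto> E d(X, z)\<^sup>2\<close> is strongly convex.
  Quadratic growth around its minimizer is the assertion, and it also makes the minimizer unique.
\<close>

lemma (in prob_space) variance_inequality:
  fixes X :: "'a \<Rightarrow> 'b::hadamard_space"
  assumes X [measurable]: "X \<in> borel_measurable M" and sq: "square_integrable M X"
  defines "m \<equiv> hadamard_expectation M X"
  shows "expectation (\<lambda>\<omega>. (dist (X \<omega>) m)\<^sup>2) + (dist m s)\<^sup>2 \<le> expectation (\<lambda>\<omega>. (dist (X \<omega>) s)\<^sup>2)"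
proof -
  define F where "F = (\<lambda>s. expectation (\<lambda>\<omega>. (dist (X \<omega>) s)\<^sup>2))"
  note int [simp] = square_integrable_dist[OF X sq]
  have "\<exists>m. \<forall>s. F m + (dist m s)\<^sup>2 \<le> F s"
  proof (rule strongly_convex_has_minimizer)
    fix x y :: 'b and t :: real
    assume t: "0 \<le> t" "t \<le> 1"
    have "F (geodesic_point x t y) \<le> expectation (\<lambda>\<omega>. (1 - t) * (dist (X \<omega>) x)\<^sup>2
        + t * (dist (X \<omega>) y)\<^sup>2 - t * (1 - t) * (dist x y)\<^sup>2)"
      unfolding F_def by (intro integral_mono cn_pointD[OF geodesic_point_cn[OF t]]) auto
    also have "\<dots> = (1 - t) * F x + t * F y - t * (1 - t) * (dist x y)\<^sup>2"
      by (simp add: F_def prob_space)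
    finally show "F (geodesic_point x t y) \<le> \<dots>" .
  next
    show "continuous_on UNIV F"
      unfolding continuous_on_sequentially comp_def
    proof (intro allI ballI impI, elim conjE)
      fix u :: "nat \<Rightarrow> 'b" and x
      assume u: "u \<longlonglongrightarrow> x"
      let ?E = "expectation (\<lambda>\<omega>. dist (X \<omega>) x)"
      have "\<bar>F (u n) - F x\<bar> \<le> dist (u n) x * (dist (u n) x + 2 * ?E)" for n
      proof -
        have "\<bar>F (u n) - F x\<bar> = \<bar>expectation (\<lambda>\<omega>. (dist (X \<omega>) (u n))\<^sup>2 - (dist (X \<omega>) x)\<^sup>2)\<bar>"
          by (simp add: F_def)
        also have "\<dots> \<le> expectation (\<lambda>\<omega>. \<bar>(dist (X \<omega>) (u n))\<^sup>2 - (dist (X \<omega>) x)\<^sup>2\<bar>)"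
          by (rule integral_abs_bound)
        also have "\<dots> \<le> expectation (\<lambda>\<omega>. dist (u n) x * (dist (u n) x + 2 * dist (X \<omega>) x))"
        proof (intro integral_mono)
          fix \<omega>
          have 1: "\<bar>dist (X \<omega>) (u n) - dist (X \<omega>) x\<bar> \<le> dist (u n) x"
            by (metis abs_dist_diff_le dist_commute)
          have "\<bar>(dist (X \<omega>) (u n))\<^sup>2 - (dist (X \<omega>) x)\<^sup>2\<bar>
              = \<bar>dist (X \<omega>) (u n) - dist (X \<omega>) x\<bar> * (dist (X \<omega>) (u n) + dist (X \<omega>) x)"
            by (simp add: power2_eq_square square_diff_square_factored abs_mult)
          also have "\<dots> \<le> dist (u n) x * (dist (u n) x + 2 * dist (X \<omega>) x)"
            using 1 by (intro mult_mono) (auto simp: abs_le_iff)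
          finally show "\<bar>(dist (X \<omega>) (u n))\<^sup>2 - (dist (X \<omega>) x)\<^sup>2\<bar> \<le> \<dots>" .
        qed auto
        also have "\<dots> = dist (u n) x * (dist (u n) x + 2 * ?E)"
          by (simp add: prob_space)
        finally show ?thesis .
      qed
      moreover have "(\<lambda>n. dist (u n) x * (dist (u n) x + 2 * ?E)) \<longlonglongrightarrow> dist x x * (dist x x + 2 * ?E)"
        by (intro tendsto_intros u)
      ultimately have "(\<lambda>n. F (u n) - F x) \<longlonglongrightarrow> 0"
        by (intro Lim_null_comparison[of "\<lambda>n. F (u n) - F x"
              "\<lambda>n. dist (u n) x * (dist (u n) x + 2 * ?E)"]) auto
      then show "(\<lambda>n. F (u n)) \<longlonglongrightarrow> F x"
        by (rule LIM_zero_cancel)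
    qed
  qed (simp add: F_def)
  then obtain m' where m': "\<And>s. F m' + (dist m' s)\<^sup>2 \<le> F s"
    by blast
  have F_eq: "expectation (\<lambda>\<omega>. (dist (X \<omega>) s)\<^sup>2) = F s" for s
    by (simp add: F_def)
  have "m = m'"
    unfolding m_def hadamard_expectation_def F_eq
  proof (rule the_equality)
    show "\<forall>z. F m' \<le> F z"
    proof
      fix z
      show "F m' \<le> F z"
        using m'[of z] zero_le_power2[of "dist m' z"] by linarith
    qed
  next
    fix x
    assume "\<forall>z. F x \<le> F z"
    then have "F x \<le> F m'"
      by simp
    with m'[of x] have "(dist m' x)\<^sup>2 \<le> 0"
      by linarith
    then show "x = m'"
      by simp
  qed
  with m'[of s] show ?thesis
    by (simp add: F_eq)
qed

section \<open>One step of the inductive mean\<close>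

lemma diff_dist_squares_le:
  "(dist x a)\<^sup>2 - (dist x b)\<^sup>2 \<le> dist a b * (dist x a + dist x b)"
proof -
  have "(dist x a)\<^sup>2 - (dist x b)\<^sup>2 = (dist x a - dist x b) * (dist x a + dist x b)"
    by (simp add: power2_eq_square algebra_simps)
  also have "\<dots> \<le> dist a b * (dist x a + dist x b)"
    using dist_triangle[of x a b] by (intro mult_right_mono) (auto simp: dist_commute)
  finally show ?thesis .
qed

text \<open>
  The scaling by \<open>(k + 1)\<^sup>2\<close> removes all fractions from the inequality at \<open>t = 1/(k+1)\<close>.
\<close>

lemma geodesic_point_step:
  fixes s x c :: "'a::hadamard_space"
  shows "(real (Suc k))\<^sup>2 * (dist (geodesic_point s (1 / real (Suc k)) x) c)\<^sup>2
    \<le> real k * real (Suc k) * (dist s c)\<^sup>2 + real (Suc k) * (dist x c)\<^sup>2 - real k * (dist x s)\<^sup>2"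
proof -
  let ?K = "real (Suc k)" and ?t = "1 / real (Suc k)"
  have "(dist c (geodesic_point s ?t x))\<^sup>2
      \<le> (1 - ?t) * (dist c s)\<^sup>2 + ?t * (dist c x)\<^sup>2 - ?t * (1 - ?t) * (dist s x)\<^sup>2"
    by (intro cn_pointD geodesic_point_cn) auto
  then have "?K\<^sup>2 * (dist c (geodesic_point s ?t x))\<^sup>2
      \<le> ?K\<^sup>2 * ((1 - ?t) * (dist c s)\<^sup>2 + ?t * (dist c x)\<^sup>2 - ?t * (1 - ?t) * (dist s x)\<^sup>2)"
    by (rule mult_left_mono) simp
  also have "\<dots> = (?K * (?K * (1 - ?t))) * (dist c s)\<^sup>2 + (?K * (?K * ?t)) * (dist c x)\<^sup>2
      - ((?K * ?t) * (?K * (1 - ?t))) * (dist s x)\<^sup>2"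
    by (simp only: power2_eq_square algebra_simps)
  also have "?K * ?t = 1"
    by simp
  also have "?K * (1 - ?t) = real k"
    by (simp add: field_simps)
  finally show ?thesis
    by (simp add: dist_commute mult.commute)
qed

text \<open>
  Both bounds follow from the variance inequality at the centre \<open>z\<close>, where the right-hand side is at
  most \<open>B\<^sup>2\<close>.
\<close>

lemma (in prob_space) hadamard_expectation_bounded:
  fixes X :: "'a \<Rightarrow> 'b::hadamard_space"
  assumes X [measurable]: "X \<in> borel_measurable M" and bnd: "AE \<omega> in M. dist (X \<omega>) z \<le> B"
    and B: "0 \<le> B"
  shows "square_integrable M X"
    and "expectation (\<lambda>\<omega>. (dist (X \<omega>) (hadamard_expectation M X))\<^sup>2) \<le> B\<^sup>2"
    and "dist (hadamard_expectation M X) z \<le> B"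
proof -
  let ?m = "hadamard_expectation M X"
  have le: "AE \<omega> in M. (dist (X \<omega>) z)\<^sup>2 \<le> B\<^sup>2"
    using bnd by eventually_elim (auto intro: power_mono)
  have "integrable M (\<lambda>\<omega>. (dist (X \<omega>) z)\<^sup>2)"
    by (rule integrable_const_bound[of _ "B\<^sup>2"]) (use le in auto)
  then show sq: "square_integrable M X"
    by (auto simp: square_integrable_def)
  have "expectation (\<lambda>\<omega>. (dist (X \<omega>) z)\<^sup>2) \<le> expectation (\<lambda>_. B\<^sup>2)"
    by (intro integral_mono_AE square_integrable_dist[OF X sq] le) auto
  then have *: "expectation (\<lambda>\<omega>. (dist (X \<omega>) ?m)\<^sup>2) + (dist ?m z)\<^sup>2 \<le> B\<^sup>2"
    using variance_inequality[OF X sq, of z] by (simp add: prob_space)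
  moreover have "0 \<le> expectation (\<lambda>\<omega>. (dist (X \<omega>) ?m)\<^sup>2)"
    by simp
  ultimately have "(dist ?m z)\<^sup>2 \<le> B\<^sup>2"
    by linarith
  then show "dist ?m z \<le> B"
    using B by (rule power2_le_imp_le)
  show "expectation (\<lambda>\<omega>. (dist (X \<omega>) ?m)\<^sup>2) \<le> B\<^sup>2"
    using * zero_le_power2[of "dist ?m z"] by linarith
qed

text \<open>
  Write \<open>V = E d(X, m)\<^sup>2\<close>. If \<open>c = m\<close>, the variance inequality leaves \<open>V \<le> B\<^sup>2\<close> on top of \<open>k\<^sup>2 d(s, c)\<^sup>2\<close>.
  Moving from \<open>m\<close> to \<open>c\<close> changes squared distances by at most \<open>4 B d(m, c)\<close>, which happens with
  the weights \<open>k + 1\<close> and \<open>k\<close>.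
\<close>

lemma (in prob_space) expectation_step_le:
  fixes X :: "'a \<Rightarrow> 'b::hadamard_space"
  assumes X [measurable]: "X \<in> borel_measurable M" and bnd: "AE \<omega> in M. dist (X \<omega>) z \<le> B"
    and s: "dist s z \<le> B" and c: "dist c z \<le> B"
  defines "m \<equiv> hadamard_expectation M X"
  shows "real k * real (Suc k) * (dist s c)\<^sup>2
      + real (Suc k) * expectation (\<lambda>\<omega>. (dist (X \<omega>) c)\<^sup>2)
      - real k * expectation (\<lambda>\<omega>. (dist (X \<omega>) s)\<^sup>2)
    \<le> (real k)\<^sup>2 * (dist s c)\<^sup>2 + B\<^sup>2 + 8 * B * real (Suc k) * dist m c"
proof -
  have B: "0 \<le> B"
    using s zero_le_dist[of s z] by linarith
  note m_bounds = hadamard_expectation_bounded[OF X bnd B, folded m_def]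
  note int [simp] = square_integrable_dist[OF X m_bounds(1)]
  define V where "V = expectation (\<lambda>\<omega>. (dist (X \<omega>) m)\<^sup>2)"
  define Ec where "Ec = expectation (\<lambda>\<omega>. (dist (X \<omega>) c)\<^sup>2)"
  define Es where "Es = expectation (\<lambda>\<omega>. (dist (X \<omega>) s)\<^sup>2)"
  define D where "D = dist m c"
  have D: "0 \<le> D"
    by (simp add: D_def)
  have "Ec - V = expectation (\<lambda>\<omega>. (dist (X \<omega>) c)\<^sup>2 - (dist (X \<omega>) m)\<^sup>2)"
    by (simp add: Ec_def V_def)
  also have "\<dots> \<le> expectation (\<lambda>_. D * (4 * B))"
  proof (rule integral_mono_AE)
    show "AE \<omega> in M. (dist (X \<omega>) c)\<^sup>2 - (dist (X \<omega>) m)\<^sup>2 \<le> D * (4 * B)"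
      using bnd
    proof eventually_elim
      case (elim \<omega>)
      have "dist (X \<omega>) c + dist (X \<omega>) m \<le> 4 * B"
        using elim c m_bounds(3) dist_triangle2[of "X \<omega>" c z] dist_triangle2[of "X \<omega>" m z]
        by linarith
      then have "dist c m * (dist (X \<omega>) c + dist (X \<omega>) m) \<le> dist c m * (4 * B)"
        by (rule mult_left_mono) simp
      with diff_dist_squares_le[of "X \<omega>" c m] show ?case
        by (simp add: D_def dist_commute)
    qed
  qed auto
  also have "\<dots> = 4 * B * D"
    by (simp add: prob_space)
  finally have Ec: "Ec \<le> V + 4 * B * D"
    by simp
  have "dist s c + dist s m \<le> 4 * B"
    using s c m_bounds(3) dist_triangle2[of s c z] dist_triangle2[of s m z] by linarith
  then have "dist c m * (dist s c + dist s m) \<le> dist c m * (4 * B)"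
    by (rule mult_left_mono) simp
  with diff_dist_squares_le[of s c m]
  have "(dist s c)\<^sup>2 - 4 * B * D \<le> (dist m s)\<^sup>2"
    by (simp add: D_def dist_commute algebra_simps)
  with variance_inequality[OF X m_bounds(1), of s]
  have Es: "V + (dist s c)\<^sup>2 - 4 * B * D \<le> Es"
    by (simp add: V_def Es_def m_def)
  have "real k * real (Suc k) * (dist s c)\<^sup>2 + real (Suc k) * Ec - real k * Es
    \<le> real k * real (Suc k) * (dist s c)\<^sup>2 + real (Suc k) * (V + 4 * B * D)
      - real k * (V + (dist s c)\<^sup>2 - 4 * B * D)"
    by (intro diff_mono add_mono mult_left_mono Ec Es) auto
  also have "\<dots> = (real k)\<^sup>2 * (dist s c)\<^sup>2 + V + 4 * (B * D) * (2 * real k + 1)"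
    by (simp add: power2_eq_square algebra_simps)
  also have "\<dots> \<le> (real k)\<^sup>2 * (dist s c)\<^sup>2 + B\<^sup>2 + 4 * (B * D) * (2 * real (Suc k))"
    using m_bounds(2) B D by (intro add_mono mult_left_mono) (auto simp: V_def)
  finally show ?thesis
    by (simp add: Ec_def Es_def D_def algebra_simps)
qed

text \<open>
  Hoeffding's lemma applied to the upper bound of \<open>geodesic_point_step\<close>, whose mean is estimated by
  \<open>expectation_step_le\<close>. As \<open>d(X, s)\<close> and \<open>d(X, c)\<close> lie between \<open>0\<close> and \<open>2 B\<close>, this variable has range
  at most \<open>(2 k + 1) 4 B\<^sup>2\<close>.
\<close>

lemma (in prob_space) exp_moment_step:
  fixes X :: "'a \<Rightarrow> 'b::hadamard_space"
  assumes X [measurable]: "X \<in> borel_measurable M" and bnd: "AE \<omega> in M. dist (X \<omega>) z \<le> B"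
    and s: "dist s z \<le> B" and c: "dist c z \<le> B" and l: "0 < l"
  shows "(\<integral>\<^sup>+\<omega>. ennreal (exp (l * ((real (Suc k))\<^sup>2 *
        (dist (geodesic_point s (1 / real (Suc k)) (X \<omega>)) c)\<^sup>2))) \<partial>M)
    \<le> ennreal (exp (l * ((real k)\<^sup>2 * (dist s c)\<^sup>2 + B\<^sup>2
          + 8 * B * real (Suc k) * dist (hadamard_expectation M X) c)
        + 8 * l\<^sup>2 * B ^ 4 * (real (Suc k))\<^sup>2))"
proof -
  have B: "0 \<le> B"
    using s zero_le_dist[of s z] by linarith
  define R where "R = (real k)\<^sup>2 * (dist s c)\<^sup>2 + B\<^sup>2
          + 8 * B * real (Suc k) * dist (hadamard_expectation M X) c"
  define A where "A = real k * real (Suc k) * (dist s c)\<^sup>2"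
  define f where "f = (\<lambda>\<omega>. A + real (Suc k) * (dist (X \<omega>) c)\<^sup>2 - real k * (dist (X \<omega>) s)\<^sup>2)"
  note int [simp] = square_integrable_dist[OF X hadamard_expectation_bounded(1)[OF X bnd B]]
  have Ef: "expectation f \<le> R"
    using expectation_step_le[OF X bnd s c, of k]
    by (simp add: f_def A_def R_def prob_space del: of_nat_Suc)
  define a where "a = A - real k * (2 * B)\<^sup>2"
  define b where "b = A + real (Suc k) * (2 * B)\<^sup>2"
  interpret interval_bounded_random_variable M f a b
  proof
    show "f \<in> borel_measurable M"
      unfolding f_def by measurable
    show "AE \<omega> in M. f \<omega> \<in> {a..b}"
      using bnd
    proof eventually_elim
      case (elim \<omega>)
      have "dist (X \<omega>) c \<le> 2 * B" "dist (X \<omega>) s \<le> 2 * B"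
        using elim s c dist_triangle2[of "X \<omega>" c z] dist_triangle2[of "X \<omega>" s z] by linarith+
      then have "(dist (X \<omega>) c)\<^sup>2 \<le> (2 * B)\<^sup>2" "(dist (X \<omega>) s)\<^sup>2 \<le> (2 * B)\<^sup>2"
        by (intro power_mono; simp)+
      then have "real (Suc k) * (dist (X \<omega>) c)\<^sup>2 \<le> real (Suc k) * (2 * B)\<^sup>2"
        "real k * (dist (X \<omega>) s)\<^sup>2 \<le> real k * (2 * B)\<^sup>2"
        by (auto intro!: mult_left_mono)
      moreover have "0 \<le> real (Suc k) * (dist (X \<omega>) c)\<^sup>2" "0 \<le> real k * (dist (X \<omega>) s)\<^sup>2"
        by auto
      ultimately show ?case
        unfolding f_def a_def b_def atLeastAtMost_iff by (intro conjI) linarith+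
    qed
  qed
  have "(b - a)\<^sup>2 = ((2 * real k + 1) * (4 * B\<^sup>2))\<^sup>2"
    by (simp add: a_def b_def algebra_simps)
  also have "\<dots> \<le> (2 * real (Suc k) * (4 * B\<^sup>2))\<^sup>2"
    by (intro power_mono mult_right_mono) auto
  also have "\<dots> = 64 * B ^ 4 * (real (Suc k))\<^sup>2"
    unfolding power_mult_distrib by (simp flip: power_mult)
  finally have "l\<^sup>2 * (b - a)\<^sup>2 \<le> l\<^sup>2 * (64 * B ^ 4 * (real (Suc k))\<^sup>2)"
    by (rule mult_left_mono) simp
  then have width: "l\<^sup>2 * (b - a)\<^sup>2 / 8 \<le> 8 * l\<^sup>2 * B ^ 4 * (real (Suc k))\<^sup>2"
    by simp
  have "(\<integral>\<^sup>+\<omega>. ennreal (exp (l * ((real (Suc k))\<^sup>2 *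
        (dist (geodesic_point s (1 / real (Suc k)) (X \<omega>)) c)\<^sup>2))) \<partial>M)
    \<le> (\<integral>\<^sup>+\<omega>. ennreal (exp (l * R)) * ennreal (exp (l * (f \<omega> - expectation f))) \<partial>M)"
  proof (rule nn_integral_mono)
    fix \<omega>
    have "(real (Suc k))\<^sup>2 * (dist (geodesic_point s (1 / real (Suc k)) (X \<omega>)) c)\<^sup>2
        \<le> R + (f \<omega> - expectation f)"
      using geodesic_point_step[of k s "X \<omega>" c] Ef unfolding f_def A_def by linarith
    then have "l * ((real (Suc k))\<^sup>2 * (dist (geodesic_point s (1 / real (Suc k)) (X \<omega>)) c)\<^sup>2)
        \<le> l * R + l * (f \<omega> - expectation f)"
      using l by (simp flip: distrib_left)
    then show "ennreal (exp (l * ((real (Suc k))\<^sup>2 *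
          (dist (geodesic_point s (1 / real (Suc k)) (X \<omega>)) c)\<^sup>2)))
        \<le> ennreal (exp (l * R)) * ennreal (exp (l * (f \<omega> - expectation f)))"
      by (simp add: ennreal_mult[symmetric] exp_add[symmetric] del: of_nat_Suc)
  qed
  also have "\<dots> = ennreal (exp (l * R)) * (\<integral>\<^sup>+\<omega>. ennreal (exp (l * (f \<omega> - expectation f))) \<partial>M)"
    by (rule nn_integral_cmult) measurable
  also have "\<dots> \<le> ennreal (exp (l * R)) * ennreal (exp (l\<^sup>2 * (b - a)\<^sup>2 / 8))"
    by (intro mult_left_mono Hoeffdings_lemma_nn_integral l) auto
  also have "\<dots> \<le> ennreal (exp (l * R + 8 * l\<^sup>2 * B ^ 4 * (real (Suc k))\<^sup>2))"
    using width by (simp add: ennreal_mult[symmetric] exp_add[symmetric] del: of_nat_Suc)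
  finally show ?thesis
    by (simp add: R_def del: of_nat_Suc)
qed

section \<open>Measurability of inductive means\<close>

text \<open>
  The closure of a countable set is the form of separability used in \<^const>\<open>hadamard_rv\<close>, here required
  at every point.
\<close>

definition separably_valued :: "('b \<Rightarrow> 'a::topological_space) \<Rightarrow> bool" where
  "separably_valued f \<longleftrightarrow> (\<exists>D. countable D \<and> range f \<subseteq> closure D)"

text \<open>
  Let \<open>j m x\<close> be the first index of a point of the dense sequence \<open>d\<close> at distance less than
  \<open>1/(m+1)\<close> from \<open>f x\<close>. Indices rather than points are returned because maps into the natural numbers
  are easy to compose measurably.
\<close>

lemma separably_valued_approximation:
  fixes f :: "'b \<Rightarrow> 'a::metric_space"
  assumes f [measurable]: "f \<in> borel_measurable N" and "separably_valued f"
  obtains d :: "nat \<Rightarrow> 'a" and j :: "nat \<Rightarrow> 'b \<Rightarrow> nat"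
  where "\<And>m. j m \<in> N \<rightarrow>\<^sub>M count_space UNIV" and "\<And>x. (\<lambda>m. d (j m x)) \<longlonglongrightarrow> f x"
proof -
  obtain D where D: "countable D" "range f \<subseteq> closure D"
    using assms(2) by (auto simp: separably_valued_def)
  then have "D \<noteq> {}"
    by auto
  define d where "d = from_nat_into D"
  define j where "j = (\<lambda>m x. LEAST i. dist (f x) (d i) < 1 / real (Suc m))"
  have [measurable]: "j m \<in> N \<rightarrow>\<^sub>M count_space UNIV" for m
    unfolding j_def by measurable
  moreover have "(\<lambda>m. d (j m x)) \<longlonglongrightarrow> f x" for x
  proof -
    have "dist (d (j m x)) (f x) \<le> 1 / real (Suc m)" for m
    proof -
      have "f x \<in> closure D"
        using D(2) by blast
      then obtain y where "y \<in> D" "dist y (f x) < 1 / real (Suc m)"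
        unfolding closure_approachable by (meson of_nat_0_less_iff zero_less_Suc zero_less_divide_1_iff)
      then have "\<exists>i. dist (f x) (d i) < 1 / real (Suc m)"
        using from_nat_into_surj[OF D(1)] by (metis d_def dist_commute)
      then show ?thesis
        unfolding j_def by (rule LeastI2_ex) (simp add: dist_commute)
    qed
    then have "(\<lambda>m. dist (d (j m x)) (f x)) \<longlonglongrightarrow> 0"
      by (intro tendsto_sandwich[OF _ _ tendsto_const LIMSEQ_Suc[OF lim_1_over_n]]) auto
    then show ?thesis
      by (subst tendsto_dist_iff)
  qed
  ultimately show ?thesis
    by (rule that)
qed

lemma continuous_on_pair_sequentially:
  assumes "continuous_on UNIV (\<lambda>(x, y). G x y)" "a \<longlonglongrightarrow> x" "b \<longlonglongrightarrow> y"
  shows "(\<lambda>n. G (a n) (b n)) \<longlonglongrightarrow> G x y"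
  using continuous_on_tendsto_compose[OF assms(1) tendsto_Pair[OF assms(2,3)]] by simp

text \<open>
  For the approximations of \<open>f\<close> and \<open>g\<close> only countably many values of \<open>G\<close> occur, so measurability is
  clear; it survives the pointwise limit. The pair \<open>(f, g)\<close> itself is never claimed to be Borel
  measurable.
\<close>

lemma borel_measurable_continuous_on_pair:
  fixes f :: "'b \<Rightarrow> 'a::metric_space" and g :: "'b \<Rightarrow> 'c::metric_space"
    and G :: "'a \<Rightarrow> 'c \<Rightarrow> 'd::metric_space"
  assumes G: "continuous_on UNIV (\<lambda>(x, y). G x y)"
    and f: "f \<in> borel_measurable N" "separably_valued f"
    and g: "g \<in> borel_measurable N" "separably_valued g"
  shows "(\<lambda>\<omega>. G (f \<omega>) (g \<omega>)) \<in> borel_measurable N"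
    and "separably_valued (\<lambda>\<omega>. G (f \<omega>) (g \<omega>))"
proof -
  obtain d i where i: "\<And>m. i m \<in> N \<rightarrow>\<^sub>M count_space (UNIV :: nat set)"
    and d: "\<And>\<omega>. (\<lambda>m. d (i m \<omega>)) \<longlonglongrightarrow> f \<omega>"
    using separably_valued_approximation[OF f] by metis
  obtain e j where j: "\<And>m. j m \<in> N \<rightarrow>\<^sub>M count_space (UNIV :: nat set)"
    and e: "\<And>\<omega>. (\<lambda>m. e (j m \<omega>)) \<longlonglongrightarrow> g \<omega>"
    using separably_valued_approximation[OF g] by metis
  have lim: "(\<lambda>m. G (d (i m \<omega>)) (e (j m \<omega>))) \<longlonglongrightarrow> G (f \<omega>) (g \<omega>)" for \<omega>
    by (rule continuous_on_pair_sequentially[OF G d e])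
  show "(\<lambda>\<omega>. G (f \<omega>) (g \<omega>)) \<in> borel_measurable N"
  proof (rule borel_measurable_LIMSEQ_metric[OF _ lim])
    fix m
    show "(\<lambda>\<omega>. G (d (i m \<omega>)) (e (j m \<omega>))) \<in> borel_measurable N"
      by (rule measurable_compose_countable[OF measurable_compose_countable[OF _ j] i]) simp
  qed
  have "G (f \<omega>) (g \<omega>) \<in> closure (range (\<lambda>(a, b). G (d a) (e b)))" for \<omega>
    unfolding closure_sequential
    by (rule exI[of _ "\<lambda>m. G (d (i m \<omega>)) (e (j m \<omega>))"]) (use lim in auto)
  then show "separably_valued (\<lambda>\<omega>. G (f \<omega>) (g \<omega>))"
    unfolding separably_valued_def
    by (intro exI[of _ "range (\<lambda>(a, b). G (d a) (e b))"]) auto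
qed

lemma inductive_mean_Suc:
  "1 \<le> k \<Longrightarrow> inductive_mean x (Suc k)
     = geodesic_point (inductive_mean x k) (1 / real (Suc k)) (x (Suc k))"
  by (cases k) auto

lemma inductive_mean_cong:
  assumes "1 \<le> k" "\<And>i. i \<in> {1..k} \<Longrightarrow> x i = y i"
  shows "inductive_mean x k = inductive_mean y k"
  using assms by (induction k rule: nat_induct_at_least) (simp_all add: inductive_mean_Suc)

lemma inductive_mean_in_cball:
  assumes "1 \<le> k" "\<And>i. i \<in> {1..k} \<Longrightarrow> x i \<in> cball z B"
  shows "inductive_mean x k \<in> cball z B"
  using assms
  by (induction k rule: nat_induct_at_least)
     (auto simp: inductive_mean_Suc simp del: mem_cball intro!: geodesic_point_in_cball)

lemma borel_measurable_inductive_mean: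
  fixes f :: "nat \<Rightarrow> 'b \<Rightarrow> 'a::hadamard_space"
  assumes "1 \<le> k" and "\<And>i. i \<in> {1..k} \<Longrightarrow> f i \<in> borel_measurable N"
    and "\<And>i. i \<in> {1..k} \<Longrightarrow> separably_valued (f i)"
  shows "(\<lambda>\<omega>. inductive_mean (\<lambda>i. f i \<omega>) k) \<in> borel_measurable N"
    and "separably_valued (\<lambda>\<omega>. inductive_mean (\<lambda>i. f i \<omega>) k)"
proof -
  have "(\<lambda>\<omega>. inductive_mean (\<lambda>i. f i \<omega>) k) \<in> borel_measurable N \<and>
    separably_valued (\<lambda>\<omega>. inductive_mean (\<lambda>i. f i \<omega>) k)"
    using assms
  proof (induction k rule: nat_induct_at_least)
    case base
    then show ?case
      by simp
  next
    case (Suc k)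
    have "continuous_on UNIV (\<lambda>(x, y). geodesic_point x (1 / real (Suc k)) y :: 'a)"
      by (rule continuous_on_geodesic_point) auto
    from borel_measurable_continuous_on_pair[OF this, of "\<lambda>\<omega>. inductive_mean (\<lambda>i. f i \<omega>) k" N "f (Suc k)"]
    show ?case
      using Suc by (simp add: inductive_mean_Suc del: of_nat_Suc)
  qed
  then show "(\<lambda>\<omega>. inductive_mean (\<lambda>i. f i \<omega>) k) \<in> borel_measurable N"
    and "separably_valued (\<lambda>\<omega>. inductive_mean (\<lambda>i. f i \<omega>) k)"
    by auto
qed

section \<open>An exponential moment bound\<close>

text \<open>
  The observations are \<open>\<rho> \<circ> W i\<close>, where \<open>\<rho>\<close> has values in a separable subset of a ball. Writing
  them this way makes the inductive mean measurable on the whole product space, so that the law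
  of the sample can be replaced by a product measure and the last coordinate be integrated first, for
  fixed values of the others. At \<open>k = 1\<close> the trivial bound \<open>u\<^sub>1 \<le> 4 B\<^sup>2\<close> is used; it is the reason for the
  factor \<open>5\<close> in place of \<open>1\<close>.
\<close>

lemma (in prob_space) exp_moment_inductive_mean:
  fixes W :: "nat \<Rightarrow> 'a \<Rightarrow> 'b::hadamard_space" and \<rho> :: "'b \<Rightarrow> 'b"
  assumes indep: "indep_vars (\<lambda>_. borel) W {1..n}" and n: "1 \<le> n"
    and \<rho> [measurable]: "\<rho> \<in> borel_measurable borel" and sep: "separably_valued \<rho>"
    and ball: "\<And>x. \<rho> x \<in> cball z B" and c: "dist c z \<le> B" and l: "0 < l"
  defines "D \<equiv> \<lambda>i. dist (hadamard_expectation M (\<lambda>\<omega>. \<rho> (W i \<omega>))) c"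
  shows "(\<integral>\<^sup>+\<omega>. ennreal (exp (l * ((real n)\<^sup>2 *
        (dist (inductive_mean (\<lambda>i. \<rho> (W i \<omega>)) n) c)\<^sup>2))) \<partial>M)
    \<le> ennreal (exp (l * (5 * B\<^sup>2 * real n + 8 * B * real n * (\<Sum>i=1..n. D i))
        + 8 * l\<^sup>2 * B ^ 4 * (real n) ^ 3))"
proof -
  have B: "0 \<le> B"
    using c zero_le_dist[of c z] by linarith
  have W [measurable]: "W i \<in> borel_measurable M" if "i \<in> {1..n}" for i
    using indep that by (auto simp: indep_vars_def)
  \<comment> \<open>Indices outside the sample get a point mass, so that every factor is a probability measure.\<close>
  define L where "L = (\<lambda>i. distr M borel (if i \<in> {1..n} then W i else (\<lambda>_. z)))"
  have L_prob: "prob_space (L i)" for i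
    unfolding L_def by (rule prob_space_distr) (use W in auto)
  have sets_L [measurable_cong]: "sets (L i) = sets borel" for i
    by (simp add: L_def)
  interpret L: product_sigma_finite L
    by (simp add: product_sigma_finite_def L_prob prob_space_imp_sigma_finite)
  define u where "u = (\<lambda>k x. (real k)\<^sup>2 * (dist (inductive_mean (\<lambda>i. \<rho> (x i)) k) c)\<^sup>2)"
  have sep_coord: "separably_valued (\<lambda>x. \<rho> (x i))" for i :: nat
    using sep by (auto simp: separably_valued_def)
  have u_measurable: "u k \<in> borel_measurable (PiM {1..k} L)" if "1 \<le> k" for k
  proof -
    have "(\<lambda>x. inductive_mean (\<lambda>i. \<rho> (x i)) k) \<in> borel_measurable (PiM {1..k} L)"
      by (rule borel_measurable_inductive_mean[OF that _ sep_coord]) measurable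
    then show ?thesis
      unfolding u_def by measurable
  qed
  define e where "e = (\<lambda>k. l * (5 * B\<^sup>2 * real k + 8 * B * real k * (\<Sum>i=1..k. D i))
        + 8 * l\<^sup>2 * B ^ 4 * (real k) ^ 3)"
  have main: "(\<integral>\<^sup>+x. ennreal (exp (l * u k x)) \<partial>PiM {1..k} L) \<le> ennreal (exp (e k))"
    if "1 \<le> k" "k \<le> n" for k
    using that
  proof (induction k rule: nat_induct_at_least)
    case base
    have "l * u 1 x \<le> e 1" for x
    proof -
      have "dist (\<rho> (x 1)) c \<le> 2 * B"
        using ball[of "x 1"] c dist_triangle2[of "\<rho> (x 1)" c z] by (simp add: dist_commute)
      then have "(dist (\<rho> (x 1)) c)\<^sup>2 \<le> (2 * B)\<^sup>2"
        by (rule power_mono) simp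
      then have "u 1 x \<le> (2 * B)\<^sup>2"
        unfolding u_def by simp
      also have "\<dots> \<le> 5 * B\<^sup>2 * real 1 + 8 * B * real 1 * (\<Sum>i=1..1. D i)"
        using B by (simp add: D_def)
      finally have "l * u 1 x \<le> l * (5 * B\<^sup>2 * real 1 + 8 * B * real 1 * (\<Sum>i=1..1. D i))"
        using l by (intro mult_left_mono) auto
      also have "\<dots> \<le> e 1"
        by (simp add: e_def)
      finally show ?thesis .
    qed
    then have "(\<integral>\<^sup>+x. ennreal (exp (l * u 1 x)) \<partial>PiM {1..1} L)
        \<le> (\<integral>\<^sup>+x. ennreal (exp (e 1)) \<partial>PiM {1..1} L)"
      by (intro nn_integral_mono ennreal_leI) simp
    also have "\<dots> = ennreal (exp (e 1))"
    proof -
      interpret P: prob_space "PiM {1..1} L"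
        by (rule prob_space_PiM) (rule L_prob)
      show ?thesis
        by (simp only: nn_integral_const P.emeasure_space_1 mult_1_right)
    qed
    finally show ?case .
  next
    case (Suc k)
    have k: "1 \<le> k" "Suc k \<in> {1..n}" "1 \<le> Suc k"
      using Suc.hyps Suc.prems by auto
    define r where "r = l * (B\<^sup>2 + 8 * B * real (Suc k) * D (Suc k))
      + 8 * l\<^sup>2 * B ^ 4 * (real (Suc k))\<^sup>2"
    have ins: "{1..Suc k} = insert (Suc k) {1..k}"
      by auto
    have inner: "(\<integral>\<^sup>+y. ennreal (exp (l * u (Suc k) (x(Suc k := y)))) \<partial>L (Suc k))
        \<le> ennreal (exp r) * ennreal (exp (l * u k x))" for x
    proof -
      define s where "s = inductive_mean (\<lambda>i. \<rho> (x i)) k"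
      have s: "dist s z \<le> B"
        using inductive_mean_in_cball[OF k(1), of "\<lambda>i. \<rho> (x i)" z B] ball
        by (simp add: s_def dist_commute)
      have u_eq: "u (Suc k) (x(Suc k := y)) = (real (Suc k))\<^sup>2 *
          (dist (geodesic_point s (1 / real (Suc k)) (\<rho> y)) c)\<^sup>2" for y
      proof -
        have "inductive_mean (\<lambda>i. \<rho> ((x(Suc k := y)) i)) k = s"
          unfolding s_def by (rule inductive_mean_cong[OF k(1)]) auto
        then show ?thesis
          by (simp add: u_def inductive_mean_Suc[OF k(1)] del: of_nat_Suc)
      qed
      have "continuous_on UNIV (\<lambda>(x, y). geodesic_point x (1 / real (Suc k)) y :: 'b)"
        by (rule continuous_on_geodesic_point) auto
      moreover have "continuous_on UNIV (\<lambda>y. (s, y))"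
        by (intro continuous_on_Pair continuous_on_const continuous_on_id)
      ultimately have "continuous_on UNIV (\<lambda>y. geodesic_point s (1 / real (Suc k)) y)"
        using continuous_on_compose2[of UNIV "\<lambda>(x, y). geodesic_point x (1 / real (Suc k)) y"
            UNIV "\<lambda>y. (s, y)"]
        by simp
      then have [measurable]: "(\<lambda>y. geodesic_point s (1 / real (Suc k)) y) \<in> borel_measurable borel"
        by (rule borel_measurable_continuous_onI)
      have "(\<integral>\<^sup>+y. ennreal (exp (l * u (Suc k) (x(Suc k := y)))) \<partial>L (Suc k))
        = (\<integral>\<^sup>+\<omega>. ennreal (exp (l * ((real (Suc k))\<^sup>2 *
            (dist (geodesic_point s (1 / real (Suc k)) (\<rho> (W (Suc k) \<omega>))) c)\<^sup>2))) \<partial>M)"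
        unfolding L_def u_eq using k(2) W[OF k(2)]
        by (subst nn_integral_distr) (auto simp del: of_nat_Suc)
      also have "\<dots> \<le> ennreal (exp (l * ((real k)\<^sup>2 * (dist s c)\<^sup>2 + B\<^sup>2
          + 8 * B * real (Suc k) * D (Suc k)) + 8 * l\<^sup>2 * B ^ 4 * (real (Suc k))\<^sup>2))"
        unfolding D_def
      proof (rule exp_moment_step[OF _ _ s c l])
        show "(\<lambda>\<omega>. \<rho> (W (Suc k) \<omega>)) \<in> borel_measurable M"
          using W[OF k(2)] by measurable
        show "AE \<omega> in M. dist (\<rho> (W (Suc k) \<omega>)) z \<le> B"
          using ball by (simp add: dist_commute)
      qed
      also have "\<dots> = ennreal (exp r) * ennreal (exp (l * u k x))"
        by (simp add: u_def s_def r_def ennreal_mult[symmetric] exp_add[symmetric] algebra_simps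
              del: of_nat_Suc)
      finally show ?thesis .
    qed
    \<comment> \<open>The sum of the squares \<open>i\<^sup>2\<close> for \<open>i \<le> k\<close> is majorized by \<open>k\<^sup>3\<close>.\<close>
    have r: "r + e k \<le> e (Suc k)"
    proof -
      have "real k * (\<Sum>i=1..k. D i) + real (Suc k) * D (Suc k) \<le> real (Suc k) * (\<Sum>i=1..Suc k. D i)"
        by (simp add: algebra_simps sum_nonneg D_def)
      then have "8 * B * (real k * (\<Sum>i=1..k. D i) + real (Suc k) * D (Suc k))
          \<le> 8 * B * (real (Suc k) * (\<Sum>i=1..Suc k. D i))"
        using B by (intro mult_left_mono) auto
      moreover have "5 * B\<^sup>2 * real k + B\<^sup>2 \<le> 5 * B\<^sup>2 * real (Suc k)"
        by (simp add: algebra_simps)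
      ultimately have "(5 * B\<^sup>2 * real k + 8 * B * real k * (\<Sum>i=1..k. D i))
          + (B\<^sup>2 + 8 * B * real (Suc k) * D (Suc k))
          \<le> 5 * B\<^sup>2 * real (Suc k) + 8 * B * real (Suc k) * (\<Sum>i=1..Suc k. D i)"
        by (simp add: distrib_left mult.assoc del: of_nat_Suc sum.cl_ivl_Suc)
      then have 1: "l * ((5 * B\<^sup>2 * real k + 8 * B * real k * (\<Sum>i=1..k. D i))
          + (B\<^sup>2 + 8 * B * real (Suc k) * D (Suc k)))
          \<le> l * (5 * B\<^sup>2 * real (Suc k) + 8 * B * real (Suc k) * (\<Sum>i=1..Suc k. D i))"
        using l by (intro mult_left_mono) auto
      have "real k ^ 3 + (real (Suc k))\<^sup>2 \<le> real (Suc k) ^ 3"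
        by (simp add: power2_eq_square power3_eq_cube algebra_simps)
      then have 2: "8 * l\<^sup>2 * B ^ 4 * (real k ^ 3 + (real (Suc k))\<^sup>2)
          \<le> 8 * l\<^sup>2 * B ^ 4 * real (Suc k) ^ 3"
        by (intro mult_left_mono) auto
      show ?thesis
        using add_mono[OF 1 2] unfolding r_def e_def
        by (simp only: distrib_left add_ac)
    qed
    have "(\<integral>\<^sup>+x. ennreal (exp (l * u (Suc k) x)) \<partial>PiM {1..Suc k} L)
        = (\<integral>\<^sup>+x. (\<integral>\<^sup>+y. ennreal (exp (l * u (Suc k) (x(Suc k := y)))) \<partial>L (Suc k)) \<partial>PiM {1..k} L)"
      unfolding ins
    proof (rule L.product_nn_integral_insert)
      have "u (Suc k) \<in> borel_measurable (PiM (insert (Suc k) {1..k}) L)"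
        using u_measurable[OF k(3)] by (simp only: ins)
      then show "(\<lambda>x. ennreal (exp (l * u (Suc k) x)))
          \<in> borel_measurable (PiM (insert (Suc k) {1..k}) L)"
        by measurable
    qed auto
    also have "\<dots> \<le> (\<integral>\<^sup>+x. ennreal (exp r) * ennreal (exp (l * u k x)) \<partial>PiM {1..k} L)"
      by (intro nn_integral_mono inner)
    also have "\<dots> = ennreal (exp r) * (\<integral>\<^sup>+x. ennreal (exp (l * u k x)) \<partial>PiM {1..k} L)"
      by (rule nn_integral_cmult) (use u_measurable[OF k(1)] in measurable)
    also have "\<dots> \<le> ennreal (exp r) * ennreal (exp (e k))"
      using Suc by (intro mult_left_mono) auto
    also have "\<dots> \<le> ennreal (exp (e (Suc k)))"
      using r by (simp add: ennreal_mult[symmetric] exp_add[symmetric])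
    finally show ?case .
  qed
  have law: "distr M (PiM {1..n} (\<lambda>_. borel)) (\<lambda>\<omega>. \<lambda>i\<in>{1..n}. W i \<omega>) = PiM {1..n} L"
  proof -
    have "distr M (PiM {1..n} (\<lambda>_. borel)) (\<lambda>\<omega>. \<lambda>i\<in>{1..n}. W i \<omega>)
        = PiM {1..n} (\<lambda>i. distr M borel (W i))"
      by (rule indep_vars_iff_distr_eq_PiM'[THEN iffD1, OF _ _ indep]) (use n W in auto)
    also have "\<dots> = PiM {1..n} L"
      by (rule PiM_cong) (auto simp: L_def)
    finally show ?thesis .
  qed
  have "(\<integral>\<^sup>+\<omega>. ennreal (exp (l * ((real n)\<^sup>2 *
        (dist (inductive_mean (\<lambda>i. \<rho> (W i \<omega>)) n) c)\<^sup>2))) \<partial>M)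
    = (\<integral>\<^sup>+\<omega>. ennreal (exp (l * u n (\<lambda>i\<in>{1..n}. W i \<omega>))) \<partial>M)"
  proof (rule nn_integral_cong)
    fix \<omega>
    have "inductive_mean (\<lambda>i. \<rho> ((\<lambda>i\<in>{1..n}. W i \<omega>) i)) n = inductive_mean (\<lambda>i. \<rho> (W i \<omega>)) n"
      by (rule inductive_mean_cong[OF n]) simp
    then show "ennreal (exp (l * ((real n)\<^sup>2 *
        (dist (inductive_mean (\<lambda>i. \<rho> (W i \<omega>)) n) c)\<^sup>2)))
      = ennreal (exp (l * u n (\<lambda>i\<in>{1..n}. W i \<omega>)))"
      by (simp only: u_def)
  qed
  also have "\<dots> = (\<integral>\<^sup>+x. ennreal (exp (l * u n x)) \<partial>PiM {1..n} L)"
    unfolding law[symmetric]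
  proof (rule nn_integral_distr[symmetric])
    have "sets (PiM {1..n} L) = sets (PiM {1..n} (\<lambda>_. borel :: 'b measure))"
      by (rule sets_PiM_cong) (auto simp: sets_L)
    then show "(\<lambda>x. ennreal (exp (l * u n x)))
        \<in> borel_measurable (distr M (PiM {1..n} (\<lambda>_. borel)) (\<lambda>\<omega>. \<lambda>i\<in>{1..n}. W i \<omega>))"
      unfolding law using u_measurable[OF n] by measurable
    show "(\<lambda>\<omega>. \<lambda>i\<in>{1..n}. W i \<omega>) \<in> M \<rightarrow>\<^sub>M PiM {1..n} (\<lambda>_. borel)"
      by (rule measurable_restrict) (rule W)
  qed
  also have "\<dots> \<le> ennreal (exp (e n))"
    by (rule main[OF n order.refl])
  finally show ?thesis
    by (simp only: e_def)
qed

section \<open>Summability of the tail bounds\<close>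

lemma summable_exp_neg_powr:
  fixes a \<kappa> :: real
  assumes "0 < a" "0 < \<kappa>"
  shows "summable (\<lambda>n. exp (- \<kappa> * real n powr a))"
proof (rule summable_comparison_test_bigo)
  show "(\<lambda>n. exp (- \<kappa> * real n powr a)) \<in> O(\<lambda>n. real n powr (-2))"
    using assms by real_asymp
  show "summable (\<lambda>n. norm (real n powr (-2)))"
    by (simp add: summable_real_powr_iff)
qed

text \<open>
  With \<open>l = \<delta> n\<^bsup>-1-4q\<^esup>\<close>, \<open>B = K n\<^sup>q\<close> and bias \<open>T n\<^bsup>1-p\<^esup>\<close> all terms are multiples of \<open>n\<^bsup>1-4q\<^esup>\<close>. The one from Markov's
  inequality has the factor \<open>- \<delta> \<epsilon>\<^sup>2\<close>, the quadratic one has \<open>8 \<delta>\<^sup>2 K\<^sup>4\<close>, and the other two have factors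
  that tend to \<open>0\<close>. The choice of \<open>\<delta>\<close> makes the quadratic term a quarter of the first.
\<close>

lemma tail_exponent_bound:
  fixes K T \<epsilon> p q :: real
  assumes K: "0 < K" and eps: "0 < \<epsilon>" and q: "q < 1/4" "q < p"
  obtains \<delta> where "0 < \<delta>"
    and "\<forall>\<^sub>F n in sequentially.
      (\<delta> * real n powr (- 1 - 4 * q)) *
        (5 * (K * real n powr q)\<^sup>2 * real n + 8 * (K * real n powr q) * real n * (T * real n powr (1 - p)))
      + 8 * (\<delta> * real n powr (- 1 - 4 * q))\<^sup>2 * (K * real n powr q) ^ 4 * (real n) ^ 3
      - (\<delta> * real n powr (- 1 - 4 * q)) * ((real n)\<^sup>2 * \<epsilon>\<^sup>2)
      \<le> - (\<delta> * \<epsilon>\<^sup>2 / 2) * real n powr (1 - 4 * q)"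
proof
  define \<delta> where "\<delta> = \<epsilon>\<^sup>2 / (32 * K ^ 4)"
  show \<delta>: "0 < \<delta>"
    using K eps by (simp add: \<delta>_def)
  have \<delta>_K: "8 * \<delta>\<^sup>2 * K ^ 4 = \<delta> * \<epsilon>\<^sup>2 / 4"
    using K by (simp add: \<delta>_def power2_eq_square field_simps)
  have "(\<lambda>n. real n powr (2 * q - 1)) \<longlonglongrightarrow> 0" "(\<lambda>n. real n powr (q - p)) \<longlonglongrightarrow> 0"
    using q by real_asymp+
  from this[THEN tendsto_mult[OF tendsto_const]]
  have "(\<lambda>n. 5 * K\<^sup>2 * real n powr (2 * q - 1) + 8 * K * T * real n powr (q - p)) \<longlonglongrightarrow> 0"
    by (intro tendsto_add_zero) auto
  then have "\<forall>\<^sub>F n in sequentially.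
      5 * K\<^sup>2 * real n powr (2 * q - 1) + 8 * K * T * real n powr (q - p) < \<epsilon>\<^sup>2 / 4"
    using eps by (intro order_tendstoD(2)[where y = 0]) auto
  with eventually_gt_at_top[of 0]
  show "\<forall>\<^sub>F n in sequentially.
      (\<delta> * real n powr (- 1 - 4 * q)) *
        (5 * (K * real n powr q)\<^sup>2 * real n + 8 * (K * real n powr q) * real n * (T * real n powr (1 - p)))
      + 8 * (\<delta> * real n powr (- 1 - 4 * q))\<^sup>2 * (K * real n powr q) ^ 4 * (real n) ^ 3
      - (\<delta> * real n powr (- 1 - 4 * q)) * ((real n)\<^sup>2 * \<epsilon>\<^sup>2)
      \<le> - (\<delta> * \<epsilon>\<^sup>2 / 2) * real n powr (1 - 4 * q)"
  proof eventually_elim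
    case (elim n)
    define x where "x = real n"
    have x: "0 < x"
      using elim by (simp add: x_def)
    define y where "y = x powr q"
    define v where "v = x powr p"
    have yv: "0 < y" "0 < v"
      using x by (auto simp: y_def v_def)
    \<comment> \<open>All exponents are expressed by \<open>x\<close>, \<open>y = x\<^sup>q\<close> and \<open>v = x\<^sup>p\<close>, so that rational arithmetic suffices.\<close>
    have e1: "x powr (- 1 - 4 * q) = 1 / (x * y ^ 4)"
      using x by (simp add: y_def powr_diff powr_minus powr_power field_simps)
    have e2: "x powr (1 - p) = x / v"
      using x by (simp add: v_def powr_diff)
    have e3: "x powr (1 - 4 * q) = x / y ^ 4"
      using x by (simp add: y_def powr_diff powr_power mult.commute)
    have e4: "x powr (2 * q - 1) = y\<^sup>2 / x"
      using x by (simp add: y_def powr_diff powr_power mult.commute)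
    have e5: "x powr (q - p) = y / v"
      using x by (simp add: y_def v_def powr_diff)
    have small: "5 * K\<^sup>2 * (y\<^sup>2 / x) + 8 * K * T * (y / v) < \<epsilon>\<^sup>2 / 4"
      using elim(2) unfolding x_def[symmetric] e4 e5 .
    have "(\<delta> * (1 / (x * y ^ 4))) * (5 * (K * y)\<^sup>2 * x + 8 * (K * y) * x * (T * (x / v)))
        + 8 * (\<delta> * (1 / (x * y ^ 4)))\<^sup>2 * (K * y) ^ 4 * x ^ 3
        - (\<delta> * (1 / (x * y ^ 4))) * (x\<^sup>2 * \<epsilon>\<^sup>2)
      = (x / y ^ 4) * (\<delta> * (5 * K\<^sup>2 * (y\<^sup>2 / x) + 8 * K * T * (y / v))
          + 8 * \<delta>\<^sup>2 * K ^ 4 - \<delta> * \<epsilon>\<^sup>2)"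
      using x yv by (simp add: divide_simps) (simp add: algebra_simps power_mult_distrib eval_nat_numeral)
    also have "\<dots> \<le> (x / y ^ 4) * (\<delta> * (\<epsilon>\<^sup>2 / 4) + \<delta> * \<epsilon>\<^sup>2 / 4 - \<delta> * \<epsilon>\<^sup>2)"
      unfolding \<delta>_K using x yv \<delta> small
      by (intro mult_left_mono diff_mono add_mono) auto
    also have "\<dots> = - (\<delta> * \<epsilon>\<^sup>2 / 2) * (x / y ^ 4)"
      by (simp add: field_simps)
    finally show ?case
      unfolding x_def[symmetric] e1 e2 e3 y_def[symmetric] .
  qed
qed

section \<open>A strong law for triangular arrays\<close>

lemma (in prob_space) inductive_mean_tail:
  fixes W :: "nat \<Rightarrow> 'a \<Rightarrow> 'b::hadamard_space" and \<rho> :: "'b \<Rightarrow> 'b"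
  assumes indep: "indep_vars (\<lambda>_. borel) W {1..n}" and n: "1 \<le> n"
    and \<rho> [measurable]: "\<rho> \<in> borel_measurable borel" and sep: "separably_valued \<rho>"
    and ball: "\<And>x. \<rho> x \<in> cball z B" and c: "dist c z \<le> B" and l: "0 < l" and eps: "0 \<le> \<epsilon>"
  defines "D \<equiv> \<lambda>i. dist (hadamard_expectation M (\<lambda>\<omega>. \<rho> (W i \<omega>))) c"
    and "A \<equiv> {\<omega>\<in>space M. \<epsilon> \<le> dist (inductive_mean (\<lambda>i. \<rho> (W i \<omega>)) n) c}"
  shows "A \<in> events"
    and "prob A \<le> exp (l * (5 * B\<^sup>2 * real n + 8 * B * real n * (\<Sum>i=1..n. D i))
        + 8 * l\<^sup>2 * B ^ 4 * (real n) ^ 3 - l * ((real n)\<^sup>2 * \<epsilon>\<^sup>2))"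
proof -
  define S where "S = (\<lambda>\<omega>. inductive_mean (\<lambda>i. \<rho> (W i \<omega>)) n)"
  have "W i \<in> borel_measurable M" if "i \<in> {1..n}" for i
    using indep that by (auto simp: indep_vars_def)
  then have "(\<lambda>\<omega>. \<rho> (W i \<omega>)) \<in> borel_measurable M" if "i \<in> {1..n}" for i
    using that by (auto intro: measurable_compose[OF _ \<rho>])
  moreover have "separably_valued (\<lambda>\<omega>. \<rho> (W i \<omega>))" for i
    using sep by (auto simp: separably_valued_def)
  ultimately have [measurable]: "S \<in> borel_measurable M"
    unfolding S_def by (intro borel_measurable_inductive_mean[OF n])
  have A: "A = {\<omega>\<in>space M. \<epsilon> \<le> dist (S \<omega>) c}"
    by (simp add: A_def S_def)
  show [measurable]: "A \<in> events"
    unfolding A by measurable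
  define e where "e = l * (5 * B\<^sup>2 * real n + 8 * B * real n * (\<Sum>i=1..n. D i))
        + 8 * l\<^sup>2 * B ^ 4 * (real n) ^ 3"
  define b where "b = l * ((real n)\<^sup>2 * \<epsilon>\<^sup>2)"
  have "emeasure M A = (\<integral>\<^sup>+\<omega>. indicator A \<omega> \<partial>M)"
    by simp
  also have "\<dots> \<le> (\<integral>\<^sup>+\<omega>. ennreal (exp (- b)) * ennreal (exp (l * ((real n)\<^sup>2 * (dist (S \<omega>) c)\<^sup>2))) \<partial>M)"
  proof (rule nn_integral_mono)
    fix \<omega>
    show "indicator A \<omega> \<le> ennreal (exp (- b)) * ennreal (exp (l * ((real n)\<^sup>2 * (dist (S \<omega>) c)\<^sup>2)))"
    proof (cases "\<omega> \<in> A")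
      case True
      then have "b \<le> l * ((real n)\<^sup>2 * (dist (S \<omega>) c)\<^sup>2)"
        unfolding A b_def using eps l by (auto intro!: mult_left_mono power_mono)
      then have "1 \<le> exp (- b + l * ((real n)\<^sup>2 * (dist (S \<omega>) c)\<^sup>2))"
        by simp
      then show ?thesis
        using True by (simp add: ennreal_mult[symmetric] exp_add[symmetric])
    qed simp
  qed
  also have "\<dots> = ennreal (exp (- b)) * (\<integral>\<^sup>+\<omega>. ennreal (exp (l * ((real n)\<^sup>2 * (dist (S \<omega>) c)\<^sup>2))) \<partial>M)"
    by (rule nn_integral_cmult) measurable
  also have "\<dots> \<le> ennreal (exp (- b)) * ennreal (exp e)"
    unfolding S_def e_def D_def
    by (intro mult_left_mono exp_moment_inductive_mean[OF indep n \<rho> sep ball c l]) auto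
  also have "\<dots> = ennreal (exp (e - b))"
    by (simp add: ennreal_mult[symmetric] exp_add[symmetric])
  finally show "prob A \<le> exp (l * (5 * B\<^sup>2 * real n + 8 * B * real n * (\<Sum>i=1..n. D i))
        + 8 * l\<^sup>2 * B ^ 4 * (real n) ^ 3 - l * ((real n)\<^sup>2 * \<epsilon>\<^sup>2))"
    by (simp add: emeasure_eq_measure e_def b_def)
qed

lemma hadamard_expectation_cong_AE:
  fixes X Y :: "'w \<Rightarrow> 'a::hadamard_space"
  assumes [measurable]: "X \<in> borel_measurable M" "Y \<in> borel_measurable M"
    and eq: "AE \<omega> in M. X \<omega> = Y \<omega>"
  shows "hadamard_expectation M X = hadamard_expectation M Y"
proof -
  have "(\<integral>\<omega>. (dist (X \<omega>) s)\<^sup>2 \<partial>M) = (\<integral>\<omega>. (dist (Y \<omega>) s)\<^sup>2 \<partial>M)" for s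
  proof (rule integral_cong_AE)
    show "AE \<omega> in M. (dist (X \<omega>) s)\<^sup>2 = (dist (Y \<omega>) s)\<^sup>2"
      using eq by eventually_elim simp
  qed measurable
  then show ?thesis
    unfolding hadamard_expectation_def by simp
qed

text \<open>
  No relation between different rows is assumed. In row \<open>n\<close> the observations almost surely lie in a
  separable closed subset of a ball around \<open>z\<close> of radius \<open>B n = K n\<^sup>q\<close>, where \<open>K\<close> is large enough for
  \<open>c\<close> to lie in that ball too. Applying the map \<open>\<rho> n\<close>, which sends all other points to \<open>z\<close>, changes
  neither the means, up to null sets, nor the expectations, and preserves independence.
\<close>

lemma (in prob_space) strong_law_triangular_array:
  fixes W :: "nat \<Rightarrow> nat \<Rightarrow> 'a \<Rightarrow> 'b::hadamard_space" and C p q :: real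
  assumes rv: "\<And>n i. i \<in> {1..n} \<Longrightarrow> hadamard_rv M (W n i)"
    and indep: "\<And>n. 1 \<le> n \<Longrightarrow> indep_vars (\<lambda>_. borel) (W n) {1..n}"
    and bnd: "\<And>n i. i \<in> {1..n} \<Longrightarrow> AE \<omega> in M. dist (W n i \<omega>) z \<le> C * real n powr q"
    and bias: "(\<lambda>n. \<Sum>i=1..n. dist (hadamard_expectation M (W n i)) c) \<in> O(\<lambda>n. real n powr (1 - p))"
    and q: "0 \<le> q" "q < 1/4" "q < p"
  shows "AE \<omega> in M. (\<lambda>n. inductive_mean (\<lambda>i. W n i \<omega>) n) \<longlonglongrightarrow> c"
proof -
  define K where "K = \<bar>C\<bar> + dist c z + 1"
  have K: "0 < K"
    by (simp add: K_def add_nonneg_pos)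
  define B where "B = (\<lambda>n. K * real n powr q)"
  have B0: "0 \<le> B n" for n
    using K by (simp add: B_def)
  have CB: "C * real n powr q \<le> B n" for n
    unfolding B_def K_def
    using abs_ge_self[of C] zero_le_dist[of c z] by (intro mult_right_mono powr_ge_zero) linarith
  have cB: "dist c z \<le> B n" if "1 \<le> n" for n
  proof -
    have "dist c z * 1 \<le> K * real n powr q"
      using that q by (intro mult_mono ge_one_powr_ge_zero) (auto simp: K_def)
    then show ?thesis
      by (simp add: B_def)
  qed
  define E where "E = (\<lambda>n i. SOME E. countable E \<and> (AE \<omega> in M. W n i \<omega> \<in> closure E))"
  have E: "countable (E n i)" "AE \<omega> in M. W n i \<omega> \<in> closure (E n i)" if "i \<in> {1..n}" for n i
  proof -
    have "\<exists>E. countable E \<and> (AE \<omega> in M. W n i \<omega> \<in> closure E)"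
      using rv[OF that] by (simp add: hadamard_rv_def)
    from someI_ex[OF this] show "countable (E n i)" "AE \<omega> in M. W n i \<omega> \<in> closure (E n i)"
      by (simp_all add: E_def)
  qed
  define U where "U = insert z (\<Union>n. \<Union>i\<in>{1..n}. E n i)"
  have U: "countable U"
    unfolding U_def by (intro countable_insert countable_UN E(1)) (auto intro: countable_finite)
  have WU: "AE \<omega> in M. W n i \<omega> \<in> closure U" if "i \<in> {1..n}" for n i
    using E(2)[OF that]
  proof eventually_elim
    case (elim \<omega>)
    have "E n i \<subseteq> U"
      using that by (auto simp: U_def)
    then show ?case
      using elim closure_mono by blast
  qed
  define \<rho> where "\<rho> = (\<lambda>n x. if x \<in> closure U \<inter> cball z (B n) then x else z)"
  have \<rho>_measurable: "\<rho> n \<in> borel_measurable borel" for n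
    unfolding \<rho>_def by (intro measurable_If_set) auto
  have \<rho>_ball: "\<rho> n x \<in> cball z (B n)" for n x
    using B0 by (auto simp: \<rho>_def)
  have \<rho>_sep: "separably_valued (\<rho> n)" for n
  proof -
    have "z \<in> closure U"
      by (rule subsetD[OF closure_subset]) (simp add: U_def)
    then have "range (\<rho> n) \<subseteq> closure U"
      by (auto simp: \<rho>_def)
    with U show ?thesis
      by (auto simp: separably_valued_def)
  qed
  have \<rho>_eq: "AE \<omega> in M. \<rho> n (W n i \<omega>) = W n i \<omega>" if "i \<in> {1..n}" for n i
    using WU[OF that] bnd[OF that]
    by eventually_elim (use CB[of n] in \<open>auto simp: \<rho>_def dist_commute\<close>)
  have W_measurable: "W n i \<in> borel_measurable M" if "i \<in> {1..n}" for n i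
    using rv[OF that] by (simp add: hadamard_rv_def)
  have expect: "hadamard_expectation M (\<lambda>\<omega>. \<rho> n (W n i \<omega>)) = hadamard_expectation M (W n i)"
    if "i \<in> {1..n}" for n i
    by (rule hadamard_expectation_cong_AE[OF _ W_measurable[OF that] \<rho>_eq[OF that]])
       (rule measurable_compose[OF W_measurable[OF that] \<rho>_measurable])
  define bias_sum where "bias_sum = (\<lambda>n. \<Sum>i=1..n. dist (hadamard_expectation M (\<lambda>\<omega>. \<rho> n (W n i \<omega>))) c)"
  obtain T where T: "\<forall>\<^sub>F n in sequentially. bias_sum n \<le> T * real n powr (1 - p)"
  proof -
    obtain T where T: "\<forall>\<^sub>F n in sequentially.
        norm (\<Sum>i=1..n. dist (hadamard_expectation M (W n i)) c) \<le> T * norm (real n powr (1 - p))"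
      using bias by (auto elim: landau_o.bigE)
    have eq: "bias_sum n = (\<Sum>i=1..n. dist (hadamard_expectation M (W n i)) c)" for n
      unfolding bias_sum_def by (rule sum.cong) (auto simp: expect)
    from T have "\<forall>\<^sub>F n in sequentially. bias_sum n \<le> T * real n powr (1 - p)"
      by eventually_elim (simp add: eq abs_le_iff)
    then show ?thesis
      by (rule that)
  qed
  define S where "S = (\<lambda>n \<omega>. inductive_mean (\<lambda>i. \<rho> n (W n i \<omega>)) n)"
  have close: "AE \<omega> in M. \<forall>\<^sub>F n in sequentially. dist (S n \<omega>) c < \<epsilon>" if eps: "0 < \<epsilon>" for \<epsilon>
  proof -
    define A where "A = (\<lambda>n. {\<omega>\<in>space M. \<epsilon> \<le> dist (S n \<omega>) c})"
    obtain \<delta> where \<delta>: "0 < \<delta>" and \<delta>_bound: "\<forall>\<^sub>F n in sequentially.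
      (\<delta> * real n powr (- 1 - 4 * q)) *
        (5 * (K * real n powr q)\<^sup>2 * real n + 8 * (K * real n powr q) * real n * (T * real n powr (1 - p)))
      + 8 * (\<delta> * real n powr (- 1 - 4 * q))\<^sup>2 * (K * real n powr q) ^ 4 * (real n) ^ 3
      - (\<delta> * real n powr (- 1 - 4 * q)) * ((real n)\<^sup>2 * \<epsilon>\<^sup>2)
      \<le> - (\<delta> * \<epsilon>\<^sup>2 / 2) * real n powr (1 - 4 * q)"
      using tail_exponent_bound[OF K eps q(2,3)] by blast
    have tail: "A n \<in> events"
        "0 < l \<Longrightarrow> prob (A n) \<le> exp (l * (5 * (B n)\<^sup>2 * real n + 8 * B n * real n * bias_sum n)
          + 8 * l\<^sup>2 * B n ^ 4 * (real n) ^ 3 - l * ((real n)\<^sup>2 * \<epsilon>\<^sup>2))" if "1 \<le> n" for n l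
      using inductive_mean_tail[OF indep[OF that] that \<rho>_measurable \<rho>_sep \<rho>_ball cB[OF that], of _ \<epsilon>]
        inductive_mean_tail(1)[OF indep[OF that] that \<rho>_measurable \<rho>_sep \<rho>_ball cB[OF that], of 1 \<epsilon>] eps
      unfolding A_def S_def bias_sum_def by auto
    have "\<forall>\<^sub>F n in sequentially.
        norm (prob (A n)) \<le> exp (- (\<delta> * \<epsilon>\<^sup>2 / 2) * real n powr (1 - 4 * q))"
      using T \<delta>_bound eventually_ge_at_top[of 1]
    proof eventually_elim
      case (elim n)
      define l where "l = \<delta> * real n powr (- 1 - 4 * q)"
      have l: "0 < l"
        using \<delta> elim(3) by (simp add: l_def)
      have "prob (A n) \<le> exp (l * (5 * (B n)\<^sup>2 * real n + 8 * B n * real n * bias_sum n)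
          + 8 * l\<^sup>2 * B n ^ 4 * (real n) ^ 3 - l * ((real n)\<^sup>2 * \<epsilon>\<^sup>2))"
        by (rule tail(2)[OF elim(3) l])
      also have "\<dots> \<le> exp (l * (5 * (B n)\<^sup>2 * real n + 8 * B n * real n * (T * real n powr (1 - p)))
          + 8 * l\<^sup>2 * B n ^ 4 * (real n) ^ 3 - l * ((real n)\<^sup>2 * \<epsilon>\<^sup>2))"
        unfolding exp_le_cancel_iff using l B0[of n] elim(1)
        by (intro diff_right_mono add_right_mono mult_left_mono add_left_mono) auto
      also have "\<dots> \<le> exp (- (\<delta> * \<epsilon>\<^sup>2 / 2) * real n powr (1 - 4 * q))"
        using elim(2) by (simp only: exp_le_cancel_iff l_def B_def)
      finally show ?case
        by simp
    qed
    moreover have "summable (\<lambda>n. exp (- (\<delta> * \<epsilon>\<^sup>2 / 2) * real n powr (1 - 4 * q)))"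
      using \<delta> eps q by (intro summable_exp_neg_powr) auto
    ultimately have "summable (\<lambda>n. prob (A n))"
      by (rule summable_comparison_test_ev)
    \<comment> \<open>Row \<open>0\<close> is empty and its mean unspecified, so the tail bound starts at row \<open>1\<close>.\<close>
    then have "summable (\<lambda>n. prob (A (Suc n)))"
      by (subst summable_Suc_iff)
    then have "AE \<omega> in M. \<forall>\<^sub>F n in sequentially. \<omega> \<in> space M - A (Suc n)"
      by (intro borel_cantelli_AE1) (auto simp: tail(1) emeasure_eq_measure)
    then show ?thesis
    proof eventually_elim
      case (elim \<omega>)
      then have "\<forall>\<^sub>F n in sequentially. dist (S (Suc n) \<omega>) c < \<epsilon>"
        by eventually_elim (auto simp: A_def)
      then show ?case
        by (rule eventually_sequentially_Suc[THEN iffD1])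
    qed
  qed
  have "AE \<omega> in M. \<forall>m. \<forall>\<^sub>F n in sequentially. dist (S n \<omega>) c < 1 / real (Suc m)"
    unfolding AE_all_countable using close by simp
  moreover have "AE \<omega> in M. \<forall>n. \<forall>i\<in>{1..n}. \<rho> n (W n i \<omega>) = W n i \<omega>"
    unfolding AE_all_countable by (intro allI AE_finite_allI) (auto simp: \<rho>_eq)
  ultimately show ?thesis
  proof eventually_elim
    case (elim \<omega>)
    have "(\<lambda>n. S n \<omega>) \<longlonglongrightarrow> c"
    proof (rule tendstoI)
      fix e :: real
      assume "0 < e"
      then obtain m where m: "1 / real (Suc m) < e"
        using nat_approx_posE by blast
      from elim(1) have "\<forall>\<^sub>F n in sequentially. dist (S n \<omega>) c < 1 / real (Suc m)"
        by blast
      then show "\<forall>\<^sub>F n in sequentially. dist (S n \<omega>) c < e"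
        using m by (auto elim: eventually_mono)
    qed
    moreover have "\<forall>\<^sub>F n in sequentially. S n \<omega> = inductive_mean (\<lambda>i. W n i \<omega>) n"
      using eventually_ge_at_top[of 1]
    proof eventually_elim
      case (elim n)
      then show ?case
        unfolding S_def using \<open>\<forall>n. \<forall>i\<in>{1..n}. \<rho> n (W n i \<omega>) = W n i \<omega>\<close>
        by (intro inductive_mean_cong) auto
    qed
    ultimately show ?case
      by (simp only: tendsto_cong)
  qed
qed

section \<open>Contaminated samples\<close>

lemma (in prob_space) indep_sets_reindex:
  assumes inj: "inj_on f I" and indep: "indep_sets F (f ` I)"
  shows "indep_sets (\<lambda>i. F (f i)) I"
proof (rule indep_setsI)
  show "F (f i) \<subseteq> events" if "i \<in> I" for i
    using indep that by (auto simp: indep_sets_def)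
next
  fix A J
  assume J: "J \<noteq> {}" "J \<subseteq> I" "finite J" and A: "\<forall>j\<in>J. A j \<in> F (f j)"
  define A' where "A' = A \<circ> the_inv_into I f"
  have A': "A' (f j) = A j" if "j \<in> J" for j
    using that J the_inv_into_f_f[OF inj] by (auto simp: A'_def)
  have "prob (\<Inter>j\<in>f ` J. A' j) = (\<Prod>j\<in>f ` J. prob (A' j))"
    using J A A' by (intro indep_setsD[OF indep]) auto
  also have "\<dots> = (\<Prod>j\<in>J. prob (A j))"
    using A' inj_on_subset[OF inj J(2)] by (simp add: prod.reindex)
  also have "(\<Inter>j\<in>f ` J. A' j) = (\<Inter>j\<in>J. A j)"
    using A' by auto
  finally show "prob (\<Inter>j\<in>J. A j) = (\<Prod>j\<in>J. prob (A j))" .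
qed

lemma (in prob_space) indep_vars_reindex:
  assumes "inj_on f I" and "indep_vars N X (f ` I)"
  shows "indep_vars (\<lambda>i. N (f i)) (\<lambda>i. X (f i)) I"
  using assms(2) indep_sets_reindex[OF assms(1)] unfolding indep_vars_def2 by fastforce

text \<open>
  The rows \<open>Z n\<close> form a triangular array to which the strong law applies. Each \<open>Y\<^sub>j\<close> with \<open>j \<le> r\<^sub>n\<close> occurs
  exactly once, so row \<open>n\<close> is an injective selection from an independent family, and the distances of its
  expectations to \<open>\<mu>0\<close> sum to at most the two given sums. Their bounds multiplied by \<open>n\<close> give the
  order \<open>n\<^bsup>1-p\<^esup>\<close>.
\<close>

theorem proposition4:
  fixes M :: "'w measure"
    and X Y :: "nat \<Rightarrow> 'w \<Rightarrow> 'a::hadamard_space"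
    and \<mu> \<nu> :: "nat \<Rightarrow> 'a"
    and r :: "nat \<Rightarrow> nat"
    and Z :: "nat \<Rightarrow> nat \<Rightarrow> 'w \<Rightarrow> 'a"
    and \<mu>0 z :: 'a
    and p q C :: real
  assumes "prob_space M"
    and "\<And>k. k \<ge> 1 \<Longrightarrow> hadamard_rv M (X k)"
    and "\<And>k. k \<ge> 1 \<Longrightarrow> hadamard_rv M (Y k)"
    and "prob_space.indep_vars M (\<lambda>_. borel) X {1..}"
    and "prob_space.indep_vars M (\<lambda>_. borel) Y {1..}"
    and "\<And>k. k \<ge> 1 \<Longrightarrow> square_integrable M (X k) \<and> hadamard_expectation M (X k) = \<mu> k"
    and "\<And>k. k \<ge> 1 \<Longrightarrow> square_integrable M (Y k) \<and> hadamard_expectation M (Y k) = \<nu> k"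
    and "\<And>n. n \<ge> 1 \<Longrightarrow> 1 \<le> r n \<and> r n \<le> n"
    and "\<And>n. n \<ge> 1 \<Longrightarrow>
           prob_space.indep_vars M (\<lambda>_. borel) (case_sum X Y) ({1..n} <+> {1..r n})"
    and "\<And>n. n \<ge> 1 \<Longrightarrow> contamination n (r n) X Y (Z n)"
    and "p > 1/2" and "C > 0" and "0 \<le> q" and "q < min (1/4) (p - 1/2)"
    and "(\<lambda>n. 1 / real n * (\<Sum>k=1..n. dist (\<mu> k) \<mu>0)) \<in> O(\<lambda>n. real n powr (- p))"
    and "(\<lambda>n. 1 / real n * (\<Sum>k=1..r n. dist (\<nu> k) \<mu>0)) \<in> O(\<lambda>n. real n powr (- p))"
    and "\<And>n. n \<ge> 1 \<Longrightarrow>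
           measure M {\<omega> \<in> space M. (MAX k\<in>{1..n}. dist (X k \<omega>) z) \<le> C * real n powr q} = 1"
    and "\<And>n. n \<ge> 1 \<Longrightarrow>
           measure M {\<omega> \<in> space M. (MAX k\<in>{1..r n}. dist (Y k \<omega>) z) \<le> C * real n powr q} = 1"
  shows "AE \<omega> in M. (\<lambda>n. inductive_mean (\<lambda>i. Z n i \<omega>) n) \<longlonglongrightarrow> \<mu>0"
proof -
  interpret prob_space M
    by fact
  note rv_X = assms(2) and rv_Y = assms(3) and mean_X = assms(6) and mean_Y = assms(7)
    and r = assms(8) and indep = assms(9) and Z = assms(10) and q = assms(13,14)
    and bias_X = assms(15) and bias_Y = assms(16) and max_X = assms(17) and max_Y = assms(18)
  have "\<forall>n\<in>{1..}. \<exists>A. \<exists>\<pi>. A \<subseteq> {1..n} \<and> bij_betw \<pi> A {1..r n} \<and>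
      (\<forall>i\<in>{1..n}. Z n i = (if i \<in> A then Y (\<pi> i) else X i))"
    using Z unfolding contamination_def by blast
  from bchoice[OF this] obtain A where
    "\<forall>n\<in>{1..}. \<exists>\<pi>. A n \<subseteq> {1..n} \<and> bij_betw \<pi> (A n) {1..r n} \<and>
      (\<forall>i\<in>{1..n}. Z n i = (if i \<in> A n then Y (\<pi> i) else X i))" ..
  from bchoice[OF this] obtain \<pi> where contam:
    "\<forall>n\<in>{1..}. A n \<subseteq> {1..n} \<and> bij_betw (\<pi> n) (A n) {1..r n} \<and>
      (\<forall>i\<in>{1..n}. Z n i = (if i \<in> A n then Y (\<pi> n i) else X i))" ..
  have A: "A n \<subseteq> {1..n}" and \<pi>: "bij_betw (\<pi> n) (A n) {1..r n}" if "1 \<le> n" for n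
    using contam that by auto
  have Z_eq: "Z n i = (if i \<in> A n then Y (\<pi> n i) else X i)" if "i \<in> {1..n}" for n i
  proof -
    have "n \<in> {1..}"
      using that by simp
    with contam that show ?thesis
      by blast
  qed
  have \<pi>_in: "\<pi> n i \<in> {1..r n}" if "1 \<le> n" "i \<in> A n" for n i
    using \<pi>[OF that(1)] that(2) by (auto simp: bij_betw_def)
  have X_bnd: "AE \<omega> in M. dist (X i \<omega>) z \<le> C * real n powr q" if "i \<in> {1..n}" for n i
  proof -
    have n: "1 \<le> n"
      using that by simp
    show ?thesis
      using AE_prob_1[OF max_X[OF n]]
    proof eventually_elim
      case (elim \<omega>)
      have "dist (X i \<omega>) z \<le> (MAX k\<in>{1..n}. dist (X k \<omega>) z)"
        using that by (intro Max_ge) auto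
      with elim show ?case
        by simp
    qed
  qed
  have Y_bnd: "AE \<omega> in M. dist (Y j \<omega>) z \<le> C * real n powr q" if "1 \<le> n" "j \<in> {1..r n}" for n j
    using AE_prob_1[OF max_Y[OF that(1)]]
  proof eventually_elim
    case (elim \<omega>)
    have "dist (Y j \<omega>) z \<le> (MAX k\<in>{1..r n}. dist (Y k \<omega>) z)"
      using that by (intro Max_ge) auto
    with elim show ?case
      by simp
  qed
  show ?thesis
  proof (rule strong_law_triangular_array[of Z z C q \<mu>0 p])
    fix n i :: nat
    assume i: "i \<in> {1..n}"
    then have n: "1 \<le> n"
      by simp
    show "hadamard_rv M (Z n i)"
      using rv_X[of i] rv_Y[of "\<pi> n i"] \<pi>_in[OF n, of i] i by (simp add: Z_eq[OF i])
    show "AE \<omega> in M. dist (Z n i \<omega>) z \<le> C * real n powr q"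
      using X_bnd[OF i] Y_bnd[OF n \<pi>_in[OF n]] by (cases "i \<in> A n") (simp_all add: Z_eq[OF i])
  next
    fix n :: nat
    assume n: "1 \<le> n"
    define \<sigma> where "\<sigma> = (\<lambda>i. if i \<in> A n then Inr (\<pi> n i) else Inl i)"
    have "inj_on \<sigma> {1..n}"
      using \<pi>[OF n] by (auto simp: inj_on_def \<sigma>_def bij_betw_def)
    moreover have "\<sigma> ` {1..n} \<subseteq> {1..n} <+> {1..r n}"
      using \<pi>_in[OF n] by (auto simp: \<sigma>_def)
    then have "indep_vars (\<lambda>_. borel) (case_sum X Y) (\<sigma> ` {1..n})"
      by (rule indep_vars_subset[OF indep[OF n]])
    ultimately have "indep_vars (\<lambda>i. borel) (\<lambda>i. case_sum X Y (\<sigma> i)) {1..n}"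
      by (rule indep_vars_reindex)
    then show "indep_vars (\<lambda>_. borel) (Z n) {1..n}"
      by (rule indep_vars_cong[THEN iffD1, rotated -1]) (auto simp: \<sigma>_def Z_eq)
  next
    let ?E = "\<lambda>n. \<Sum>i=1..n. dist (hadamard_expectation M (Z n i)) \<mu>0"
    let ?S = "\<lambda>n. (\<Sum>k=1..n. dist (\<mu> k) \<mu>0) + (\<Sum>k=1..r n. dist (\<nu> k) \<mu>0)"
    have sum_le: "?E n \<le> ?S n" if n: "1 \<le> n" for n
    proof -
      have "?E n = (\<Sum>i\<in>{1..n} - A n. dist (hadamard_expectation M (Z n i)) \<mu>0)
          + (\<Sum>i\<in>A n. dist (hadamard_expectation M (Z n i)) \<mu>0)"
        using A[OF n] by (intro sum.subset_diff) auto
      also have "(\<Sum>i\<in>{1..n} - A n. dist (hadamard_expectation M (Z n i)) \<mu>0)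
          = (\<Sum>i\<in>{1..n} - A n. dist (\<mu> i) \<mu>0)"
        using mean_X by (intro sum.cong) (auto simp: Z_eq)
      also have "\<dots> \<le> (\<Sum>i=1..n. dist (\<mu> i) \<mu>0)"
        by (intro sum_mono2) auto
      also have "(\<Sum>i\<in>A n. dist (hadamard_expectation M (Z n i)) \<mu>0)
          = (\<Sum>i\<in>A n. dist (\<nu> (\<pi> n i)) \<mu>0)"
      proof (rule sum.cong[OF refl])
        fix i
        assume i: "i \<in> A n"
        then have "Z n i = Y (\<pi> n i)"
          using A[OF n] by (subst Z_eq) auto
        then show "dist (hadamard_expectation M (Z n i)) \<mu>0 = dist (\<nu> (\<pi> n i)) \<mu>0"
          using mean_Y[of "\<pi> n i"] \<pi>_in[OF n i] by simp
      qed
      also have "\<dots> = (\<Sum>k=1..r n. dist (\<nu> k) \<mu>0)"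
        by (rule sum.reindex_bij_betw[OF \<pi>[OF n]])
      finally show ?thesis
        by simp
    qed
    let ?mean = "\<lambda>n. 1 / real n * (\<Sum>k=1..n. dist (\<mu> k) \<mu>0)
        + 1 / real n * (\<Sum>k=1..r n. dist (\<nu> k) \<mu>0)"
    have "(\<lambda>n. real n * ?mean n) \<in> O(\<lambda>n. real n * real n powr (- p))"
      by (intro landau_o.big.mult sum_in_bigo bias_X bias_Y) simp
    also have "(\<lambda>n. real n * real n powr (- p)) \<in> O(\<lambda>n. real n powr (1 - p))"
      by (intro bigoI[of _ 1] always_eventually) (auto simp: powr_diff powr_minus divide_simps)
    finally have "(\<lambda>n. real n * ?mean n) \<in> O(\<lambda>n. real n powr (1 - p))" .
    moreover have "\<forall>\<^sub>F n in sequentially. real n * ?mean n = ?S n"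
      using eventually_gt_at_top[of 0] by eventually_elim (simp add: field_simps)
    ultimately have S: "?S \<in> O(\<lambda>n. real n powr (1 - p))"
      by (simp only: landau_o.big.in_cong)
    have "?E \<in> O(?S)"
    proof (rule bigoI[of _ 1])
      show "\<forall>\<^sub>F n in sequentially. norm (?E n) \<le> 1 * norm (?S n)"
        using eventually_ge_at_top[of 1]
      proof eventually_elim
        case (elim n)
        have "0 \<le> ?E n"
          by (intro sum_nonneg) simp
        with sum_le[OF elim] show ?case
          by simp
      qed
    qed
    from landau_o.big_trans[OF this S] show "?E \<in> O(\<lambda>n. real n powr (1 - p))" .
  qed (use q in auto)
qed

end
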